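(* Let $\mathcal A$ and $\mathfrak A$ be triangular limit algebras, each of which is isometrically isomorphic to the tensor algebra of a $\mathrm C^*$-correspondence, and let $G$ and $\mathfrak G$ be the topological graphs associated with $\mathcal R(\mathcal A)$ and $\mathcal R(\mathfrak A)$ respectively (with respect to their unique continuous coherent $\mathbb Z_0^+$-valued cocycles). If $\mathcal A$ and $\mathfrak A$ are isometrically isomorphic as algebras, then $G$ and $\mathfrak G$ are conjugate as topological graphs.
   Context: Limit algebras. An AF $\mathrm C^*$-algebra is written $\mathcal C=\varinjlim(\mathcal C_n,\rho_n)$ where each $\mathcal C_n$ is a finite direct sum of full matrix algebras with its standard matrix units and each $\rho_n$ is an injective $*$-homomorphism which is regular (maps matrix units to sums of matrix units); we identify $\mathcal C_n$ with its image in $\mathcal C$. Let $\mathcal D_n\subseteq\mathcal C_n$ be the diagonal matrices; $\mathcal D=\varinjlim(\mathcal D_n,\rho_n)$ is called a regular canonical masa. A limit algebra is a norm-closed subalgebra $\mathcal A$ with $\mathcal D\subseteq\mathcal A\subseteq\mathcal C$ for such $\mathcal D,\mathcal C$; then $\mathcal A=\varinjlim(\mathcal A_n,\rho_n)$ with $\mathcal A_n=\mathcal A\cap\mathcal C_n$. It is triangular if $\mathcal A\cap\mathcal A^*=\mathcal D$. A matrix unit in $\mathcal A$ is a matrix unit of some $\mathcal C_n$ belonging to $\mathcal A_n$. Fundamental relation. Let $\mathcal D^\star$ be the Gelfand spectrum of $\mathcal D$ and, for a projection $p\in\mathcal D$, $\tilde p=\{x\in\mathcal D^\star: x(p)=1\}$.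 A matrix unit $e$ in $\mathcal A$ induces a partial homeomorphism $\widetilde{ee^*}\ni x\mapsto x(e\,\cdot\,e^* )\in\widetilde{e^*e}$; let $\hat e\subseteq\mathcal D^\star\times\mathcal D^\star$ be its graph. Put $\mathcal R(\mathcal A)=\bigcup\{\hat e: e \text{ a matrix unit in }\bigcup_n\mathcal A_n\}$, with the topology having the sets $\hat e$ as a basis of open sets, and partial product $(x,y)(y,z)=(x,z)$. Cocycles. A function $\delta:\mathcal R(\mathcal A)\to\mathbb R$ is a cocycle if (i) $\delta(x,z)=\delta(x,y)+\delta(y,z)$ for all $(x,y),(y,z)\in\mathcal R(\mathcal A)$ and (ii) $\delta^{-1}(\{0\})=\widehat{\mathcal D}:=\bigcup\{\hat e: e\text{ a matrix unit in }\mathcal D\}$. It is $\mathbb Z_0^+$-valued if its values lie in $\mathbb Z_0^+=\{0,1,2,\dots\}$. An integer-valued cocycle is coherent if for each $k\ge2$ every element of $\delta^{-1}(\{k\})$ is a product of $k$ elements of $\delta^{-1}(\{1\})$. When a triangular limit algebra $\mathcal A$ is isometrically isomorphic to a tensor algebra, a continuous coherent $\mathbb Z_0^+$-valued cocycle $\delta$ on $\mathcal R(\mathcal A)$ exists and is unique. Associated graph. $G^0=\mathcal D^\star$, $G^1=\{(x,y)\in\mathcal R(\mathcal A):\delta(x,y)=1\}$ with the topology whose basis consists of the sets $\hat e\subseteq G^1$, $e$ a matrix unit in $\mathcal A$ (the relative topology of $\mathcal R(\mathcal A)$), $r(x,y)=x$, $s(x,y)=y$. (A topological graph consists of locally compact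 spaces $G^0,G^1$, a continuous map $r:G^1\to G^0$ and a local homeomorphism $s:G^1\to G^0$.) Conjugacy. Topological graphs $G=(G^0,G^1,r,s)$ and $\mathfrak G=(\mathfrak G^0,\mathfrak G^1,r,s)$ are conjugate if there are homeomorphisms $\varphi_0:G^0\to\mathfrak G^0$ and $\varphi_1:G^1\to\mathfrak G^1$ with $r\circ\varphi_1=\varphi_0\circ r$ and $s\circ\varphi_1=\varphi_0\circ s$. Tensor algebras. A $\mathrm C^*$-correspondence $(X,D)$ is a (right) Hilbert $D$-module $X$ over a $\mathrm C^*$-algebra $D$ with a $*$-homomorphism $\varphi:D\to L(X)$ into the adjointable operators. A Toeplitz representation $(\pi,t)$ into a $\mathrm C^*$-algebra $B$ consists of a $*$-homomorphism $\pi:D\to B$ and a linear map $t:X\to B$ with $\pi(d)t(\xi)=t(\varphi(d)\xi)$ and $t(\xi)^*t(\eta)=\pi(\langle\xi,\eta\rangle)$. If $(\pi_\infty,t_\infty)$ is the universal Toeplitz representation, the tensor algebra $\mathcal T_X^+$ is the norm-closed algebra generated by $\pi_\infty(D)$ and $t_\infty(X)$. *)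

theory Defs
  imports "HOL-Analysis.Analysis"
begin

class scaleC =
  fixes scaleC :: "complex \<Rightarrow> 'a \<Rightarrow> 'a" (infixr "*\<^sub>C" 75)

class complex_vector = scaleC + ab_group_add +
  assumes scaleC_add_right: "c *\<^sub>C (x + y) = c *\<^sub>C x + c *\<^sub>C y"
    and scaleC_add_left: "(b + c) *\<^sub>C x = b *\<^sub>C x + c *\<^sub>C x"
    and scaleC_scaleC: "b *\<^sub>C (c *\<^sub>C x) = (b * c) *\<^sub>C x"
    and scaleC_one: "1 *\<^sub>C x = x"

interpretation complex_vector: vector_space "scaleC :: complex \<Rightarrow> 'a \<Rightarrow> 'a::complex_vector"
  by unfold_locales
    (simp_all add: scaleC_add_right scaleC_add_left scaleC_scaleC scaleC_one)

text \<open>Not necessarily unital.\<close>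

class cstar_algebra = complex_vector + banach + real_normed_algebra +
  fixes star :: "'a \<Rightarrow> 'a"
  assumes scaleR_scaleC: "r *\<^sub>R x = complex_of_real r *\<^sub>C x"
    and scaleC_mult_left: "(c *\<^sub>C x) * y = c *\<^sub>C (x * y)"
    and scaleC_mult_right: "x * (c *\<^sub>C y) = c *\<^sub>C (x * y)"
    and norm_scaleC: "norm (c *\<^sub>C x) = cmod c * norm x"
    and star_star: "star (star x) = x"
    and star_add: "star (x + y) = star x + star y"
    and star_scaleC: "star (c *\<^sub>C x) = cnj c *\<^sub>C star x"
    and star_mult: "star (x * y) = star y * star x"
    and cstar_identity: "norm (star x * x) = (norm x)\<^sup>2"

definition subalgebra :: "'a::cstar_algebra set \<Rightarrow> bool" where
  "subalgebra S \<longleftrightarrow> complex_vector.subspace S \<and> (\<forall>x\<in>S. \<forall>y\<in>S. x * y \<in> S)"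

definition isometric_isomorphism ::
    "'a::cstar_algebra set \<Rightarrow> 'b::cstar_algebra set \<Rightarrow> ('a \<Rightarrow> 'b) \<Rightarrow> bool" where
  "isometric_isomorphism S T f \<longleftrightarrow>
     bij_betw f S T \<and>
     (\<forall>x\<in>S. \<forall>y\<in>S. f (x + y) = f x + f y) \<and>
     (\<forall>c. \<forall>x\<in>S. f (c *\<^sub>C x) = c *\<^sub>C f x) \<and>
     (\<forall>x\<in>S. \<forall>y\<in>S. f (x * y) = f x * f y) \<and>
     (\<forall>x\<in>S. norm (f x) = norm x)"

definition isometrically_isomorphic ::
    "'a::cstar_algebra set \<Rightarrow> 'b::cstar_algebra set \<Rightarrow> bool" where
  "isometrically_isomorphic S T \<longleftrightarrow> (\<exists>f. isometric_isomorphism S T f)"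

text \<open>
  A chain of finite-dimensional C*-algebras, already identified with subalgebras of the limit:
  the algebra at level \<open>n\<close> is the direct sum of full matrix algebras of the sizes listed in
  \<open>block_sizes n\<close>, and \<open>munit n k i j\<close> is the image in the limit of the
  standard \<open>(i,j)\<close> matrix unit of its \<open>k\<close>-th summand.
\<close>

record 'c mu_chain =
  block_sizes :: "nat \<Rightarrow> nat list"
  munit :: "nat \<Rightarrow> nat \<Rightarrow> nat \<Rightarrow> nat \<Rightarrow> 'c"

definition mu_index :: "('c, 'z) mu_chain_scheme \<Rightarrow> nat \<Rightarrow> (nat \<times> nat \<times> nat) set" where
  "mu_index M n =
     {(k, i, j). k < length (block_sizes M n) \<and> i < block_sizes M n ! k \<and> j < block_sizes M n ! k}"

definition matrix_units :: "('c, 'z) mu_chain_scheme \<Rightarrow> nat \<Rightarrow> 'c set" where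
  "matrix_units M n = {munit M n k i j | k i j. (k, i, j) \<in> mu_index M n}"

definition level_algebra :: "('c::cstar_algebra, 'z) mu_chain_scheme \<Rightarrow> nat \<Rightarrow> 'c set" where
  "level_algebra M n = complex_vector.span (matrix_units M n)"

definition level_diagonal :: "('c::cstar_algebra, 'z) mu_chain_scheme \<Rightarrow> nat \<Rightarrow> 'c set" where
  "level_diagonal M n =
     complex_vector.span {munit M n k i i | k i. (k, i, i) \<in> mu_index M n}"

text \<open>
  The type \<open>'c\<close> is the AF algebra. The first two clauses and non-vanishing of the
  matrix units say that the \<open>n\<close>-th level is a faithful *-homomorphic image of the direct
  sum of matrix algebras; the connecting maps are the inclusions, whose regularity is the
  penultimate clause.
\<close>

definition regular_af_chain :: "('c::cstar_algebra, 'z) mu_chain_scheme \<Rightarrow> bool" where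
  "regular_af_chain M \<longleftrightarrow>
     (\<forall>n k i j k' i' j'. (k, i, j) \<in> mu_index M n \<longrightarrow> (k', i', j') \<in> mu_index M n \<longrightarrow>
        munit M n k i j * munit M n k' i' j' =
          (if k = k' \<and> j = i' then munit M n k i j' else 0)) \<and>
     (\<forall>n k i j. (k, i, j) \<in> mu_index M n \<longrightarrow> star (munit M n k i j) = munit M n k j i) \<and>
     (\<forall>n k i j. (k, i, j) \<in> mu_index M n \<longrightarrow> munit M n k i j \<noteq> 0) \<and>
     (\<forall>n. 0 \<notin> set (block_sizes M n)) \<and>
     (\<forall>n. \<forall>e\<in>matrix_units M n. \<exists>F\<subseteq>matrix_units M (Suc n). e = \<Sum>F) \<and>
     closure (\<Union>n. level_algebra M n) = UNIV"

definition diagonal :: "('c::cstar_algebra, 'z) mu_chain_scheme \<Rightarrow> 'c set" where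
  "diagonal M = closure (\<Union>n. level_diagonal M n)"

definition limit_algebra :: "('c::cstar_algebra, 'z) mu_chain_scheme \<Rightarrow> 'c set \<Rightarrow> bool" where
  "limit_algebra M A \<longleftrightarrow>
     regular_af_chain M \<and> subalgebra A \<and> closed A \<and> diagonal M \<subseteq> A"

definition triangular_limit_algebra ::
    "('c::cstar_algebra, 'z) mu_chain_scheme \<Rightarrow> 'c set \<Rightarrow> bool" where
  "triangular_limit_algebra M A \<longleftrightarrow> limit_algebra M A \<and> A \<inter> star ` A = diagonal M"

definition matrix_units_in :: "('c, 'z) mu_chain_scheme \<Rightarrow> 'c set \<Rightarrow> 'c set" where
  "matrix_units_in M A = (\<Union>n. matrix_units M n) \<inter> A"

text \<open>Characters are taken to be \<open>undefined\<close> outside the algebra, as in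
  \<^const>\<open>product_topology\<close>.\<close>

definition characters :: "'c::cstar_algebra set \<Rightarrow> ('c \<Rightarrow> complex) set" where
  "characters D =
     {x \<in> extensional D.
        (\<forall>a\<in>D. \<forall>b\<in>D. x (a + b) = x a + x b) \<and>
        (\<forall>c. \<forall>a\<in>D. x (c *\<^sub>C a) = c * x a) \<and>
        (\<forall>a\<in>D. \<forall>b\<in>D. x (a * b) = x a * x b) \<and>
        (\<exists>a\<in>D. x a \<noteq> 0)}"

definition gelfand_spectrum :: "'c::cstar_algebra set \<Rightarrow> ('c \<Rightarrow> complex) topology" where
  "gelfand_spectrum D = subtopology (product_topology (\<lambda>_. euclidean) D) (characters D)"

definition support :: "'c::cstar_algebra set \<Rightarrow> 'c \<Rightarrow> ('c \<Rightarrow> complex) set" where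
  "support D p = {x \<in> characters D. x p = 1}"

definition graph_of ::
    "'c::cstar_algebra set \<Rightarrow> 'c \<Rightarrow> (('c \<Rightarrow> complex) \<times> ('c \<Rightarrow> complex)) set" where
  "graph_of D e = {(x, \<lambda>d\<in>D. x (e * d * star e)) | x. x \<in> support D (e * star e)}"

definition fundamental_relation ::
    "('c::cstar_algebra, 'z) mu_chain_scheme \<Rightarrow> 'c set \<Rightarrow> (('c \<Rightarrow> complex) \<times> ('c \<Rightarrow> complex)) set" where
  "fundamental_relation M A = (\<Union>e\<in>matrix_units_in M A. graph_of (diagonal M) e)"

text \<open>Two graphs of matrix units are disjoint or nested, so the generating sets are a basis.\<close>

definition fundamental_topology ::
    "('c::cstar_algebra, 'z) mu_chain_scheme \<Rightarrow> 'c set \<Rightarrow>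
     (('c \<Rightarrow> complex) \<times> ('c \<Rightarrow> complex)) topology" where
  "fundamental_topology M A =
     topology_generated_by (graph_of (diagonal M) ` matrix_units_in M A)"

definition cocycle ::
    "('c::cstar_algebra, 'z) mu_chain_scheme \<Rightarrow> 'c set \<Rightarrow>
     (('c \<Rightarrow> complex) \<times> ('c \<Rightarrow> complex) \<Rightarrow> real) \<Rightarrow> bool" where
  "cocycle M A \<delta> \<longleftrightarrow>
     (\<forall>x y z. (x, y) \<in> fundamental_relation M A \<longrightarrow> (y, z) \<in> fundamental_relation M A \<longrightarrow>
        \<delta> (x, z) = \<delta> (x, y) + \<delta> (y, z)) \<and>
     {g \<in> fundamental_relation M A. \<delta> g = 0} =
       (\<Union>e\<in>matrix_units_in M (diagonal M). graph_of (diagonal M) e)"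

definition coherent ::
    "('c::cstar_algebra, 'z) mu_chain_scheme \<Rightarrow> 'c set \<Rightarrow>
     (('c \<Rightarrow> complex) \<times> ('c \<Rightarrow> complex) \<Rightarrow> real) \<Rightarrow> bool" where
  "coherent M A \<delta> \<longleftrightarrow>
     (\<forall>k\<ge>2. \<forall>x y. (x, y) \<in> fundamental_relation M A \<longrightarrow> \<delta> (x, y) = real k \<longrightarrow>
        (\<exists>p :: nat \<Rightarrow> 'c \<Rightarrow> complex. p 0 = x \<and> p k = y \<and>
           (\<forall>i<k. (p i, p (Suc i)) \<in> fundamental_relation M A \<and> \<delta> (p i, p (Suc i)) = 1)))"

definition continuous_coherent_cocycle ::
    "('c::cstar_algebra, 'z) mu_chain_scheme \<Rightarrow> 'c set \<Rightarrow>
     (('c \<Rightarrow> complex) \<times> ('c \<Rightarrow> complex) \<Rightarrow> real) \<Rightarrow> bool" where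
  "continuous_coherent_cocycle M A \<delta> \<longleftrightarrow>
     cocycle M A \<delta> \<and>
     (\<forall>g\<in>fundamental_relation M A. \<delta> g \<in> \<nat>) \<and>
     continuous_map (fundamental_topology M A) euclideanreal \<delta> \<and>
     coherent M A \<delta>"

record ('v, 'e) topgraph =
  vertices :: "'v topology"
  edges :: "'e topology"
  range_map :: "'e \<Rightarrow> 'v"
  source_map :: "'e \<Rightarrow> 'v"

definition conjugate :: "('v, 'e) topgraph \<Rightarrow> ('w, 'f) topgraph \<Rightarrow> bool" where
  "conjugate G H \<longleftrightarrow>
     (\<exists>\<phi>0 \<phi>1. homeomorphic_map (vertices G) (vertices H) \<phi>0 \<and>
        homeomorphic_map (edges G) (edges H) \<phi>1 \<and>
        (\<forall>g\<in>topspace (edges G).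
           range_map H (\<phi>1 g) = \<phi>0 (range_map G g) \<and>
           source_map H (\<phi>1 g) = \<phi>0 (source_map G g)))"

definition associated_graph ::
    "('c::cstar_algebra, 'z) mu_chain_scheme \<Rightarrow> 'c set \<Rightarrow>
     (('c \<Rightarrow> complex) \<times> ('c \<Rightarrow> complex) \<Rightarrow> real) \<Rightarrow>
     ('c \<Rightarrow> complex, ('c \<Rightarrow> complex) \<times> ('c \<Rightarrow> complex)) topgraph" where
  "associated_graph M A \<delta> =
     \<lparr>vertices = gelfand_spectrum (diagonal M),
      edges = subtopology (fundamental_topology M A) {g \<in> fundamental_relation M A. \<delta> g = 1},
      range_map = fst,
      source_map = snd\<rparr>"

record ('d, 'x) correspondence =
  right_act :: "'x \<Rightarrow> 'd \<Rightarrow> 'x"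
  ip :: "'x \<Rightarrow> 'x \<Rightarrow> 'd"
  left_act :: "'d \<Rightarrow> 'x \<Rightarrow> 'x"

definition module_norm :: "('d::cstar_algebra, 'x, 'z) correspondence_scheme \<Rightarrow> 'x \<Rightarrow> real" where
  "module_norm X x = sqrt (norm (ip X x x))"

definition hilbert_module ::
    "('d::cstar_algebra, 'x::complex_vector, 'z) correspondence_scheme \<Rightarrow> bool" where
  "hilbert_module X \<longleftrightarrow>
     (\<forall>x y d. right_act X (x + y) d = right_act X x d + right_act X y d) \<and>
     (\<forall>x d e. right_act X x (d + e) = right_act X x d + right_act X x e) \<and>
     (\<forall>c x d. right_act X (c *\<^sub>C x) d = c *\<^sub>C right_act X x d) \<and>
     (\<forall>c x d. right_act X x (c *\<^sub>C d) = c *\<^sub>C right_act X x d) \<and>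
     (\<forall>x d e. right_act X (right_act X x d) e = right_act X x (d * e)) \<and>
     (\<forall>x y z. ip X x (y + z) = ip X x y + ip X x z) \<and>
     (\<forall>c x y. ip X x (c *\<^sub>C y) = c *\<^sub>C ip X x y) \<and>
     (\<forall>x y d. ip X x (right_act X y d) = ip X x y * d) \<and>
     (\<forall>x y. ip X y x = star (ip X x y)) \<and>
     (\<forall>x. \<exists>b. ip X x x = star b * b) \<and>
     (\<forall>x. ip X x x = 0 \<longrightarrow> x = 0) \<and>
     Metric_space.mcomplete UNIV (\<lambda>x y. module_norm X (x - y))"

definition is_adjoint ::
    "('d, 'x, 'z) correspondence_scheme \<Rightarrow> ('x \<Rightarrow> 'x) \<Rightarrow> ('x \<Rightarrow> 'x) \<Rightarrow> bool" where
  "is_adjoint X S T \<longleftrightarrow> (\<forall>x y. ip X (S x) y = ip X x (T y))"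

text \<open>The last clause says at once that each \<open>left_act X d\<close> is adjointable (linearity and
  boundedness are then automatic) and that the left action preserves adjoints.\<close>

definition cstar_correspondence ::
    "('d::cstar_algebra, 'x::complex_vector, 'z) correspondence_scheme \<Rightarrow> bool" where
  "cstar_correspondence X \<longleftrightarrow>
     hilbert_module X \<and>
     (\<forall>d e x. left_act X (d + e) x = left_act X d x + left_act X e x) \<and>
     (\<forall>c d x. left_act X (c *\<^sub>C d) x = c *\<^sub>C left_act X d x) \<and>
     (\<forall>d e x. left_act X (d * e) x = left_act X d (left_act X e x)) \<and>
     (\<forall>d. is_adjoint X (left_act X d) (left_act X (star d)))"

text \<open>
  The universal property ranges over all C*-algebras, whereas a formula cannot quantify over
  types of class \<^class>\<open>cstar_algebra\<close>. The algebras tested against are therefore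
  C*-algebra structures on subsets of a type.
\<close>

record 'a cstar_data =
  cs_carrier :: "'a set"
  cs_zero :: 'a
  cs_add :: "'a \<Rightarrow> 'a \<Rightarrow> 'a"
  cs_scale :: "complex \<Rightarrow> 'a \<Rightarrow> 'a"
  cs_mult :: "'a \<Rightarrow> 'a \<Rightarrow> 'a"
  cs_star :: "'a \<Rightarrow> 'a"
  cs_norm :: "'a \<Rightarrow> real"

definition cs_dist :: "('a, 'z) cstar_data_scheme \<Rightarrow> 'a \<Rightarrow> 'a \<Rightarrow> real" where
  "cs_dist B x y = cs_norm B (cs_add B x (cs_scale B (-1) y))"

definition is_cstar :: "('a, 'z) cstar_data_scheme \<Rightarrow> bool" where
  "is_cstar B \<longleftrightarrow>
     cs_zero B \<in> cs_carrier B \<and>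
     (\<forall>x\<in>cs_carrier B. cs_star B x \<in> cs_carrier B \<and>
        (\<forall>c. cs_scale B c x \<in> cs_carrier B) \<and>
        (\<forall>y\<in>cs_carrier B. cs_add B x y \<in> cs_carrier B \<and> cs_mult B x y \<in> cs_carrier B)) \<and>
     (\<forall>x\<in>cs_carrier B. \<forall>y\<in>cs_carrier B. \<forall>z\<in>cs_carrier B.
        cs_add B (cs_add B x y) z = cs_add B x (cs_add B y z) \<and>
        cs_mult B (cs_mult B x y) z = cs_mult B x (cs_mult B y z) \<and>
        cs_mult B (cs_add B x y) z = cs_add B (cs_mult B x z) (cs_mult B y z) \<and>
        cs_mult B x (cs_add B y z) = cs_add B (cs_mult B x y) (cs_mult B x z)) \<and>
     (\<forall>x\<in>cs_carrier B. \<forall>y\<in>cs_carrier B.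
        cs_add B x y = cs_add B y x \<and>
        cs_star B (cs_add B x y) = cs_add B (cs_star B x) (cs_star B y) \<and>
        cs_star B (cs_mult B x y) = cs_mult B (cs_star B y) (cs_star B x) \<and>
        cs_norm B (cs_add B x y) \<le> cs_norm B x + cs_norm B y \<and>
        cs_norm B (cs_mult B x y) \<le> cs_norm B x * cs_norm B y \<and>
        (\<forall>c. cs_scale B c (cs_add B x y) = cs_add B (cs_scale B c x) (cs_scale B c y) \<and>
             cs_mult B (cs_scale B c x) y = cs_scale B c (cs_mult B x y) \<and>
             cs_mult B x (cs_scale B c y) = cs_scale B c (cs_mult B x y))) \<and>
     (\<forall>x\<in>cs_carrier B.
        cs_add B (cs_zero B) x = x \<and>
        cs_add B x (cs_scale B (-1) x) = cs_zero B \<and>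
        cs_scale B 1 x = x \<and>
        (\<forall>b c. cs_scale B (b + c) x = cs_add B (cs_scale B b x) (cs_scale B c x) \<and>
               cs_scale B b (cs_scale B c x) = cs_scale B (b * c) x) \<and>
        cs_star B (cs_star B x) = x \<and>
        (\<forall>c. cs_star B (cs_scale B c x) = cs_scale B (cnj c) (cs_star B x)) \<and>
        0 \<le> cs_norm B x \<and>
        (cs_norm B x = 0 \<longleftrightarrow> x = cs_zero B) \<and>
        (\<forall>c. cs_norm B (cs_scale B c x) = cmod c * cs_norm B x) \<and>
        cs_norm B (cs_mult B (cs_star B x) x) = (cs_norm B x)\<^sup>2) \<and>
     Metric_space.mcomplete (cs_carrier B) (cs_dist B)"

definition cstar_on :: "'a::cstar_algebra set \<Rightarrow> 'a cstar_data" where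
  "cstar_on S = \<lparr>cs_carrier = S, cs_zero = 0, cs_add = (+), cs_scale = (*\<^sub>C), cs_mult = (*),
                 cs_star = star, cs_norm = norm\<rparr>"

lemma is_cstar_UNIV: "is_cstar (cstar_on (UNIV :: 'a::cstar_algebra set))"
proof -
  have minus: "(-1) *\<^sub>C x = - x" for x :: 'a
    using complex_vector.scale_minus_left[of 1 x] by (simp add: scaleC_one)
  have "cs_dist (cstar_on (UNIV :: 'a set)) = dist"
    by (intro ext) (simp add: cs_dist_def cstar_on_def minus dist_norm)
  moreover have "Met_TC.mcomplete (TYPE('a))"
    using complete_UNIV by (simp add: mcomplete_iff_complete)
  ultimately show ?thesis
    by (simp add: is_cstar_def cstar_on_def minus scaleC_add_right scaleC_add_left scaleC_scaleC
        scaleC_one scaleC_mult_left scaleC_mult_right norm_scaleC star_star star_add star_scaleC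
        star_mult cstar_identity norm_triangle_ineq norm_mult_ineq algebra_simps)
qed

definition star_hom ::
    "('a, 'y) cstar_data_scheme \<Rightarrow> ('b, 'z) cstar_data_scheme \<Rightarrow> ('a \<Rightarrow> 'b) \<Rightarrow> bool" where
  "star_hom P Q f \<longleftrightarrow>
     (\<forall>x\<in>cs_carrier P. f x \<in> cs_carrier Q) \<and>
     (\<forall>x\<in>cs_carrier P. \<forall>y\<in>cs_carrier P. f (cs_add P x y) = cs_add Q (f x) (f y)) \<and>
     (\<forall>c. \<forall>x\<in>cs_carrier P. f (cs_scale P c x) = cs_scale Q c (f x)) \<and>
     (\<forall>x\<in>cs_carrier P. \<forall>y\<in>cs_carrier P. f (cs_mult P x y) = cs_mult Q (f x) (f y)) \<and>
     (\<forall>x\<in>cs_carrier P. f (cs_star P x) = cs_star Q (f x))"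

definition toeplitz_rep ::
    "('d::cstar_algebra, 'x::complex_vector, 'y) correspondence_scheme \<Rightarrow>
     ('b, 'z) cstar_data_scheme \<Rightarrow> ('d \<Rightarrow> 'b) \<Rightarrow> ('x \<Rightarrow> 'b) \<Rightarrow> bool" where
  "toeplitz_rep X B \<pi> t \<longleftrightarrow>
     star_hom (cstar_on UNIV) B \<pi> \<and>
     (\<forall>\<xi>. t \<xi> \<in> cs_carrier B) \<and>
     (\<forall>\<xi> \<eta>. t (\<xi> + \<eta>) = cs_add B (t \<xi>) (t \<eta>)) \<and>
     (\<forall>c \<xi>. t (c *\<^sub>C \<xi>) = cs_scale B c (t \<xi>)) \<and>
     (\<forall>d \<xi>. cs_mult B (\<pi> d) (t \<xi>) = t (left_act X d \<xi>)) \<and>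
     (\<forall>\<xi> \<eta>. cs_mult B (cs_star B (t \<xi>)) (t \<eta>) = \<pi> (ip X \<xi> \<eta>))"

definition generated_cstar :: "'a::cstar_algebra set \<Rightarrow> 'a set" where
  "generated_cstar S = (\<lambda>T. subalgebra T \<and> closed T \<and> star ` T \<subseteq> T) hull S"

text \<open>
  Sequences of finite sums of words in the elements \<open>\<pi> d\<close>, \<open>t \<xi>\<close> and
  \<open>star (t \<xi>)\<close>. Every element of the C*-algebra generated by a Toeplitz representation is
  the limit of such a sequence, so that algebra has an isomorphic copy carried by a subset of this
  type: testing universality on this type amounts to testing it on all C*-algebras.
\<close>

type_synonym ('d, 'x) word_sums = "nat \<Rightarrow> ('d + 'x + 'x) list list"

definition universal_toeplitz ::
    "('d::cstar_algebra, 'x::complex_vector, 'z) correspondence_scheme \<Rightarrow>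
     ('d \<Rightarrow> 'b::cstar_algebra) \<Rightarrow> ('x \<Rightarrow> 'b) \<Rightarrow> bool" where
  "universal_toeplitz X \<pi> t \<longleftrightarrow>
     toeplitz_rep X (cstar_on UNIV) \<pi> t \<and>
     (\<forall>(B :: ('d, 'x) word_sums cstar_data) \<sigma> \<tau>. is_cstar B \<longrightarrow> toeplitz_rep X B \<sigma> \<tau> \<longrightarrow>
        (\<exists>\<rho>. star_hom (cstar_on (generated_cstar (range \<pi> \<union> range t))) B \<rho> \<and>
             (\<forall>d. \<rho> (\<pi> d) = \<sigma> d) \<and> (\<forall>\<xi>. \<rho> (t \<xi>) = \<tau> \<xi>)))"

definition tensor_algebra :: "('d \<Rightarrow> 'b::cstar_algebra) \<Rightarrow> ('x \<Rightarrow> 'b) \<Rightarrow> 'b set" where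
  "tensor_algebra \<pi> t = (\<lambda>S. subalgebra S \<and> closed S) hull (range \<pi> \<union> range t)"

end

theory Submission
  imports Defs
begin

text \<open>
  An element of the diagonal \<open>D\<close> is a limit of combinations of projections. An isometric homomorphism sends
  projections to contractive idempotents, and these are self-adjoint in a C*-algebra. So an isometric
  isomorphism \<open>f\<close> of triangular algebras maps diagonal onto diagonal and induces a homeomorphism of
  the Gelfand spectra. The fundamental relation is described without matrix units: it is the union
  over \<open>a \<in> A\<close> of the sets of pairs \<open>(x, y)\<close> for which the norms of \<open>p a q\<close> stay away from \<open>0\<close> as
  \<open>p\<close>, \<open>q\<close> run over the contractions in \<open>D\<close> with \<open>x p = 1\<close> and \<open>y q = 1\<close>. These sets also generate its topology, so
  \<open>f\<close> induces an isomorphism of topological relations. Finally, the edges of the associated graph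
  are the off-diagonal elements of the relation that are not products of two
  off-diagonal elements, whatever the coherent cocycle is.
\<close>

section \<open>C*-algebras\<close>

text \<open>Two obstacles shape the proof. The isomorphism is given on \<open>A\<close> alone and
  the two chains are unrelated, so it has no reason to send matrix units to matrix units; what is
  transported must be expressed by norms, products and the diagonal. And an element of
  \<open>A\<close> is approximated by elements of the levels of the chain that need not lie in
  \<open>A\<close>. Norms of corners detect the relation for this reason. Let \<open>x\<close> and
  \<open>y\<close> be 1 on diagonal units \<open>p\<close> and \<open>q\<close> of a deep level, and
  let \<open>b\<close> in that level be close to \<open>a\<close>. Then \<open>p * b * q\<close> is
  a multiple of a single matrix unit \<open>u\<close>. If the corners of \<open>a\<close> stay away
  from 0, the scalar is not small; then \<open>y\<close> must be the image of \<open>x\<close> under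
  \<open>u\<close>, and \<open>u\<close> must itself belong to \<open>A\<close>. The last claim is
  the hard one: corners are rescaled at deeper levels, where orthogonality keeps the total error as
  small as a single one. The algebras need not have a unit, which accounts for the form of the
  series used.\<close>

interpretation star: additive "star :: 'a::cstar_algebra \<Rightarrow> 'a"
  by unfold_locales (rule star_add)

lemma star_zero [simp]: "star (0::'a::cstar_algebra) = 0"
  by (rule star.zero)

declare star_star [simp]

lemma norm_star [simp]: "norm (star x) = norm (x::'a::cstar_algebra)"
proof -
  have le: "norm y \<le> norm (star y)" for y :: 'a
  proof (cases "y = 0")
    case False
    have "norm y * norm y \<le> norm (star y) * norm y"
      using cstar_identity[of y] norm_mult_ineq[of "star y" y] by (simp add: power2_eq_square)
    then show ?thesis using False by simp
  qed simp
  show ?thesis using le[of x] le[of "star x"] by simp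
qed

lemma norm_mult_star: "norm (x * star x) = (norm (x::'a::cstar_algebra))\<^sup>2"
  using cstar_identity[of "star x"] by simp

lemma star_scaleR: "star (r *\<^sub>R x) = r *\<^sub>R star (x::'a::cstar_algebra)"
  by (simp add: scaleR_scaleC star_scaleC)

lemma bounded_linear_star: "bounded_linear (star :: 'a::cstar_algebra \<Rightarrow> 'a)"
  by (rule bounded_linear_intro[where K=1]) (simp_all add: star_add star_scaleR)

lemma norm_projection_le_1:
  fixes p :: "'a::cstar_algebra"
  assumes "star p = p" "p * p = p"
  shows "norm p \<le> 1"
  using cstar_identity[of p] assms by (cases "p = 0") (simp_all add: power2_eq_square)

lemma norm_projection_eq_1:
  fixes p :: "'a::cstar_algebra"
  assumes "star p = p" "p * p = p" "p \<noteq> 0"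
  shows "norm p = 1"
  using cstar_identity[of p] assms by (simp add: power2_eq_square)

lemma norm_mult_le_1:
  fixes x y :: "'a::real_normed_algebra"
  assumes "norm x \<le> 1" "norm y \<le> c"
  shows "norm (x * y) \<le> c" "norm (y * x) \<le> c"
proof -
  have "norm x * norm y \<le> 1 * c"
    using assms norm_ge_zero[of y] by (intro mult_mono) linarith+
  then show "norm (x * y) \<le> c" "norm (y * x) \<le> c"
    using norm_mult_ineq[of x y] norm_mult_ineq[of y x] by (simp_all add: mult.commute)
qed

text \<open>
  With \<open>n = q q\<^sup>* - q\<close> and \<open>y = q (1 - t q\<^sup>* q)\<^bsup>1/2\<^esup>\<close> one has
  \<open>y n\<^sup>* = 0\<close>, \<open>n n\<^sup>* = (q q\<^sup>*)\<^sup>2 - q q\<^sup>*\<close> and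
  \<open>y y\<^sup>* = q q\<^sup>* - t (q q\<^sup>*)\<^sup>2\<close>. Hence
  \<open>(y + n) (y + n)\<^sup>*\<close> tends to \<open>0\<close> as \<open>t\<close> tends to \<open>1\<close>, which forces \<open>n = 0\<close>. The parameter
  \<open>t < 1\<close> makes the binomial series converge geometrically.
\<close>

lemma contractive_idempotent_selfadjoint:
  fixes q :: "'a::cstar_algebra"
  assumes idem: "q * q = q" and contr: "norm q \<le> 1"
  shows "star q = q"
proof -
  define h where "h = star q * q"
  define n where "n = q * star q - q"
  \<comment> \<open>\<open>v k\<close> is \<open>q\<close> followed by \<open>k\<close> factors
    \<open>h\<close>; a separate power of \<open>h\<close> would need a unit at exponent 0.\<close>
  define v where "v k = ((\<lambda>z. z * h) ^^ k) q" for k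
  have v0: "v 0 = q" and vSuc: "v (Suc k) = v k * h" for k
    by (simp_all add: v_def)
  have normh: "norm h \<le> 1"
    using contr by (simp add: h_def cstar_identity power_le_one)
  have normv: "norm (v k) \<le> 1" for k
    by (induction k) (use contr normh in \<open>auto simp: v0 vSuc intro: norm_mult_le_1\<close>)
  have idem': "star q * star q = star q"
    using idem by (metis star_mult)
  have starn: "star n = q * star q - star q"
    by (simp add: n_def star.diff star_mult)
  have qn: "q * star n = 0"
    by (simp add: starn right_diff_distrib mult.assoc[symmetric] idem)
  have vn: "v k * star n = 0" for k
    by (cases k) (simp_all add: v0 vSuc qn mult.assoc h_def)
  have vv: "v i * star (v j) = v (i + j) * star q" for i j
  proof (induction j arbitrary: i)
    case (Suc j)
    have "v i * star (v (Suc j)) = v (Suc i) * star (v j)"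
      by (simp add: vSuc star_mult h_def mult.assoc)
    then show ?case using Suc[of "Suc i"] by simp
  qed (simp add: v0)
  have nn: "n * star n = (q * star q) * (q * star q) - q * star q"
  proof -
    have "n * star n = q * star q * star n"
      using qn by (simp add: n_def left_diff_distrib)
    then show ?thesis
      by (simp add: starn right_diff_distrib mult.assoc idem')
  qed
  have bound: "(norm n)\<^sup>2 \<le> 1 - t" if t: "0 < t" "t < 1" for t :: real
  proof -
    define a where "a k = ((1/2) gchoose k) * (-t) ^ k" for k
    define y where "y = (\<Sum>k. a k *\<^sub>R v k)"
    have gle: "\<bar>(1/2::real) gchoose k\<bar> \<le> 1" for k
    proof (induction k)
      case (Suc k)
      have "((1/2::real) gchoose Suc k) = ((1/2) gchoose k) * ((1/2 - real k) / (real k + 1))"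
        by (simp add: gbinomial_Suc_rec gbinomial_absorption' field_simps)
      then have "\<bar>(1/2::real) gchoose Suc k\<bar> =
          \<bar>(1/2) gchoose k\<bar> * (\<bar>1/2 - real k\<bar> / (real k + 1))"
        by (simp add: abs_mult)
      also have "\<dots> \<le> 1 * 1"
        using Suc by (intro mult_mono) (auto simp: field_simps)
      finally show ?case by simp
    qed simp
    have anorm: "norm (a k *\<^sub>R v k) \<le> t ^ k" for k
    proof -
      have "\<bar>a k\<bar> \<le> 1 * t ^ k"
        unfolding a_def abs_mult using t gle[of k] by (intro mult_mono) (auto simp: power_abs)
      then have "\<bar>a k\<bar> * norm (v k) \<le> t ^ k * 1"
        using normv[of k] t by (intro mult_mono) auto
      then show ?thesis by simp
    qed
    have summ: "summable (\<lambda>k. norm (a k *\<^sub>R v k))"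
      by (rule summable_comparison_test'[OF summable_geometric[of t], of 0])
        (use t anorm in auto)
    have summ': "summable (\<lambda>k. a k *\<^sub>R v k)"
      using summ by (rule summable_norm_cancel)
    have "y * star n = (\<Sum>k. (a k *\<^sub>R v k) * star n)"
      unfolding y_def by (rule suminf_mult2[OF summ'])
    then have yn: "y * star n = 0" by (simp add: vn)
    then have ny: "n * star y = 0"
      using star_mult[of y "star n"] by simp
    have stary: "star y = (\<Sum>k. star (a k *\<^sub>R v k))"
      unfolding y_def by (rule bounded_linear.suminf[OF bounded_linear_star summ'])
    \<comment> \<open>Vandermonde's identity with 1/2 + 1/2 = 1: the square of the binomial series
      is \<open>1 - t z\<close>, so only the terms with \<open>k\<close> equal to 0 or 1 survive
      below.\<close>
    have conv: "(\<Sum>i\<le>k. (a i *\<^sub>R v i) * star (a (k - i) *\<^sub>R v (k - i))) =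
        ((1 gchoose k) * (-t) ^ k) *\<^sub>R (v k * star q)" for k
    proof -
      have "(a i *\<^sub>R v i) * star (a (k - i) *\<^sub>R v (k - i)) =
          ((((1/2) gchoose i) * ((1/2) gchoose (k - i))) * (-t) ^ k) *\<^sub>R (v k * star q)"
        if "i \<le> k" for i
      proof -
        have "a (k - i) * a i = (((1/2) gchoose i) * ((1/2) gchoose (k - i))) * (-t) ^ k"
          using that by (simp add: a_def power_add[symmetric])
        moreover have "v i * star (v (k - i)) = v k * star q"
          using that by (simp add: vv)
        ultimately show ?thesis
          by (simp add: star_scaleR)
      qed
      then have "(\<Sum>i\<le>k. (a i *\<^sub>R v i) * star (a (k - i) *\<^sub>R v (k - i))) =
          (\<Sum>i\<le>k. ((((1/2) gchoose i) * ((1/2) gchoose (k - i))) * (-t) ^ k) *\<^sub>R (v k * star q))"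
        by simp
      also have "\<dots> = ((\<Sum>i\<le>k. ((1/2) gchoose i) * ((1/2) gchoose (k - i))) * (-t) ^ k) *\<^sub>R
          (v k * star q)"
        by (simp add: scaleR_sum_left sum_distrib_right)
      finally show ?thesis
        using gbinomial_Vandermonde[of "1/2::real" "1/2" k] by (simp add: atLeast0AtMost)
    qed
    have "y * star y = (\<Sum>k. \<Sum>i\<le>k. (a i *\<^sub>R v i) * star (a (k - i) *\<^sub>R v (k - i)))"
      unfolding stary unfolding y_def
      by (rule Cauchy_product) (use summ in simp_all)
    also have "\<dots> = (\<Sum>k\<in>{0,1}. ((1 gchoose k) * (-t) ^ k) *\<^sub>R (v k * star q))"
      unfolding conv
    proof (rule suminf_finite)
      fix k :: nat
      assume "k \<notin> {0, 1}"
      then have "(1::real) gchoose k = 0"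
        using binomial_gbinomial[of 1 k, where 'a=real] by (simp add: binomial_eq_0)
      then show "((1 gchoose k) * (-t) ^ k) *\<^sub>R (v k * star q) = 0" by simp
    qed simp
    also have "\<dots> = q * star q - t *\<^sub>R ((q * star q) * (q * star q))"
      by (simp add: v0 vSuc[of 0, simplified] h_def mult.assoc)
    finally have yy: "y * star y = q * star q - t *\<^sub>R ((q * star q) * (q * star q))" .
    have "(y + n) * star (y + n) = y * star y + n * star n"
      by (simp add: star_add distrib_left distrib_right yn ny)
    also have "\<dots> = (1 - t) *\<^sub>R ((q * star q) * (q * star q))"
      by (simp add: yy nn scaleR_left_diff_distrib)
    finally have "(norm (y + n))\<^sup>2 = (1 - t) * norm ((q * star q) * (q * star q))"
      using norm_mult_star[of "y + n"] t by simp
    also have "\<dots> \<le> (1 - t) * 1"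
      using t contr by (intro mult_left_mono norm_mult_le_1)
        (auto simp: norm_mult_star power_le_one)
    finally have yn_le: "(norm (y + n))\<^sup>2 \<le> 1 - t" by simp
    \<comment> \<open>Since \<open>y * star n = 0\<close>, the product
      \<open>(y + n) * star n\<close> is \<open>n * star n\<close>, and a bound for
      \<open>y + n\<close> passes to \<open>n\<close>.\<close>
    have "(norm n)\<^sup>2 = norm ((y + n) * star n)"
      by (simp add: distrib_right yn norm_mult_star)
    also have "\<dots> \<le> norm (y + n) * norm n"
      using norm_mult_ineq[of "y + n" "star n"] by simp
    finally have "norm n \<le> norm (y + n)"
      by (cases "n = 0") (simp_all add: power2_eq_square)
    then have "(norm n)\<^sup>2 \<le> (norm (y + n))\<^sup>2" by (simp add: power_mono)
    with yn_le show ?thesis by linarith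
  qed
  have "(norm n)\<^sup>2 \<le> 0"
  proof (rule field_le_epsilon)
    fix e :: real
    assume "0 < e"
    \<comment> \<open>The maximum with 1/2 keeps the parameter positive even when \<open>e\<close>
      is at least 1.\<close>
    then have "(norm n)\<^sup>2 \<le> 1 - max (1/2) (1 - e)"
      by (intro bound) auto
    then show "(norm n)\<^sup>2 \<le> 0 + e" by linarith
  qed
  then have "q = q * star q" by (simp add: n_def)
  then show ?thesis by (metis star_mult star_star)
qed

text \<open>Squaring kills the cross terms and leaves the sum of the squares, again self-adjoint and
  orthogonal, with \<open>c\<close> replaced by its square. After \<open>k\<close> squarings the
  triangle inequality costs only the factor \<open>card I\<close>.\<close>

lemma norm_orthogonal_selfadjoint_sum_power_le:
  fixes h :: "'i \<Rightarrow> 'a::cstar_algebra"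
  assumes "finite I" "\<And>i. i \<in> I \<Longrightarrow> star (h i) = h i" "\<And>i. i \<in> I \<Longrightarrow> norm (h i) \<le> c"
    and "\<And>i j. i \<in> I \<Longrightarrow> j \<in> I \<Longrightarrow> i \<noteq> j \<Longrightarrow> h i * h j = 0"
  shows "norm (sum h I) ^ (2 ^ k) \<le> real (card I) * c ^ (2 ^ k)"
  using assms(2-)
proof (induction k arbitrary: h c)
  case 0
  show ?case using sum_norm_bound[of I h c] 0 by simp
next
  case (Suc k)
  have "sum h I * sum h I = (\<Sum>i\<in>I. \<Sum>j\<in>I. h i * h j)"
    by (rule sum_product)
  also have "\<dots> = (\<Sum>i\<in>I. \<Sum>j\<in>I. if i = j then h i * h i else 0)"
    using Suc.prems(3) by (intro sum.cong refl) auto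
  finally have sq: "sum h I * sum h I = (\<Sum>i\<in>I. h i * h i)"
    using assms(1) by simp
  have "star (sum h I) = sum h I"
    by (simp add: star.sum Suc.prems(1))
  then have "norm (sum h I) ^ 2 = norm (\<Sum>i\<in>I. h i * h i)"
    using cstar_identity[of "sum h I"] sq by simp
  moreover have "norm (\<Sum>i\<in>I. h i * h i) ^ (2 ^ k) \<le> real (card I) * (c\<^sup>2) ^ (2 ^ k)"
  proof (rule Suc.IH)
    fix i assume i: "i \<in> I"
    show "star (h i * h i) = h i * h i"
      by (simp add: star_mult Suc.prems(1)[OF i])
    have "norm (h i) * norm (h i) \<le> c * c"
      using Suc.prems(2)[OF i] order_trans[OF norm_ge_zero Suc.prems(2)[OF i]]
      by (intro mult_mono) auto
    then show "norm (h i * h i) \<le> c\<^sup>2"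
      using norm_mult_ineq[of "h i" "h i"] by (simp add: power2_eq_square)
    fix j assume j: "j \<in> I" and "i \<noteq> j"
    then show "h i * h i * (h j * h j) = 0"
      using Suc.prems(3)[OF i j] by (metis mult.assoc mult_zero_left mult_zero_right)
  qed
  ultimately show ?case
    by (simp add: power_mult)
qed

text \<open>On taking roots of order \<open>2 ^ k\<close> in the previous bound, the factor
  \<open>card I\<close> disappears in the limit.\<close>

lemma norm_orthogonal_selfadjoint_sum_le:
  fixes h :: "'i \<Rightarrow> 'a::cstar_algebra"
  assumes "finite I" "\<And>i. i \<in> I \<Longrightarrow> star (h i) = h i" "\<And>i. i \<in> I \<Longrightarrow> norm (h i) \<le> c"
    and "\<And>i j. i \<in> I \<Longrightarrow> j \<in> I \<Longrightarrow> i \<noteq> j \<Longrightarrow> h i * h j = 0" and c: "0 < c"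
  shows "norm (sum h I) \<le> c"
proof (rule ccontr)
  assume "\<not> norm (sum h I) \<le> c"
  then have r: "1 < norm (sum h I) / c" using c by simp
  obtain k where "real (card I) < (norm (sum h I) / c) ^ k"
    using real_arch_pow[OF r] by blast
  also have "\<dots> \<le> (norm (sum h I) / c) ^ (2 ^ k)"
    using r by (intro power_increasing) auto
  finally have "real (card I) * c ^ (2 ^ k) < norm (sum h I) ^ (2 ^ k)"
    using c by (simp add: power_divide field_simps)
  moreover have "norm (sum h I) ^ (2 ^ k) \<le> real (card I) * c ^ (2 ^ k)"
    by (rule norm_orthogonal_selfadjoint_sum_power_le) (use assms in auto)
  ultimately show False by simp
qed

text \<open>Reduction to the self-adjoint case: \<open>o1\<close> removes the cross terms of
  \<open>star (sum y I) * sum y I\<close>, and \<open>o2\<close> makes the remaining summands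
  \<open>star (y i) * y i\<close> orthogonal. This is what keeps errors at orthogonal matrix units
  from adding up.\<close>

lemma norm_orthogonal_sum_le:
  fixes y :: "'i \<Rightarrow> 'a::cstar_algebra"
  assumes fin: "finite I" and le: "\<And>i. i \<in> I \<Longrightarrow> norm (y i) \<le> c" and c: "0 < c"
    and o1: "\<And>i j. i \<in> I \<Longrightarrow> j \<in> I \<Longrightarrow> i \<noteq> j \<Longrightarrow> star (y i) * y j = 0"
    and o2: "\<And>i j. i \<in> I \<Longrightarrow> j \<in> I \<Longrightarrow> i \<noteq> j \<Longrightarrow> y i * star (y j) = 0"
  shows "norm (sum y I) \<le> c"
proof -
  have "star (sum y I) * sum y I = (\<Sum>i\<in>I. \<Sum>j\<in>I. star (y i) * y j)"
    by (simp add: star.sum sum_product)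
  also have "\<dots> = (\<Sum>i\<in>I. \<Sum>j\<in>I. if i = j then star (y i) * y i else 0)"
    using o1 by (intro sum.cong refl) auto
  finally have "star (sum y I) * sum y I = (\<Sum>i\<in>I. star (y i) * y i)"
    using fin by simp
  moreover have "norm (\<Sum>i\<in>I. star (y i) * y i) \<le> c\<^sup>2"
  proof (rule norm_orthogonal_selfadjoint_sum_le[OF fin])
    fix i assume i: "i \<in> I"
    show "star (star (y i) * y i) = star (y i) * y i" by (simp add: star_mult)
    show "norm (star (y i) * y i) \<le> c\<^sup>2" using le[OF i] by (simp add: cstar_identity power_mono)
    fix j assume "j \<in> I" "i \<noteq> j"
    then have "y i * star (y j) = 0" using o2 i by blast
    then show "star (y i) * y i * (star (y j) * y j) = 0"
      by (metis mult.assoc mult_zero_left mult_zero_right)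
  qed (use c in simp)
  ultimately have "(norm (sum y I))\<^sup>2 \<le> c\<^sup>2"
    using cstar_identity[of "sum y I"] by simp
  then show ?thesis using c by (simp add: power2_le_iff_abs_le)
qed

section \<open>Characters of closed subalgebras\<close>

lemma character_add: "x \<in> characters D \<Longrightarrow> a \<in> D \<Longrightarrow> b \<in> D \<Longrightarrow> x (a + b) = x a + x b"
  and character_scaleC: "x \<in> characters D \<Longrightarrow> a \<in> D \<Longrightarrow> x (c *\<^sub>C a) = c * x a"
  and character_mult: "x \<in> characters D \<Longrightarrow> a \<in> D \<Longrightarrow> b \<in> D \<Longrightarrow> x (a * b) = x a * x b"
  and character_extensional: "x \<in> characters D \<Longrightarrow> x \<in> extensional D"
  and character_nonzero: "x \<in> characters D \<Longrightarrow> \<exists>a\<in>D. x a \<noteq> 0"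
  by (simp_all add: characters_def)

lemma subalgebra_subspace: "subalgebra S \<Longrightarrow> complex_vector.subspace S"
  and subalgebra_mult: "subalgebra S \<Longrightarrow> x \<in> S \<Longrightarrow> y \<in> S \<Longrightarrow> x * y \<in> S"
  by (simp_all add: subalgebra_def)

lemma character_diff:
  assumes "subalgebra D" "x \<in> characters D" "a \<in> D" "b \<in> D"
  shows "x (a - b) = x a - x b"
proof -
  have "a - b \<in> D"
    using assms complex_vector.subspace_diff subalgebra_subspace by blast
  then show ?thesis using character_add[OF assms(2), of "a - b" b] assms by simp
qed

text \<open>Characters are not assumed bounded; completeness forces it. If \<open>cmod (x d)\<close>
  exceeded \<open>norm d\<close>, rescaling would give \<open>e\<close> with \<open>x e = 1\<close>
  and norm below 1. The sum \<open>s\<close> of the powers of \<open>e\<close>, from the first on,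
  would satisfy \<open>s = e * s + e\<close>, whence \<open>x s = x s + 1\<close>.\<close>

lemma character_norm_le:
  assumes sub: "subalgebra D" and cl: "closed D" and x: "x \<in> characters D" and d: "d \<in> D"
  shows "cmod (x d) \<le> norm d"
proof (rule ccontr)
  assume less: "\<not> cmod (x d) \<le> norm d"
  then have nz: "x d \<noteq> 0" by auto
  note ss = subalgebra_subspace[OF sub]
  define e where "e = (1 / x d) *\<^sub>C d"
  have e: "e \<in> D" "x e = 1"
    using d nz complex_vector.subspace_scale[OF ss] by (simp_all add: e_def character_scaleC[OF x])
  have "norm e < 1"
    using less nz by (simp add: e_def norm_scaleC norm_divide field_simps)
  define v where "v k = ((\<lambda>z. e * z) ^^ k) e" for k
  have v0: "v 0 = e" and vSuc: "v (Suc k) = e * v k" for k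
    by (simp_all add: v_def)
  have vD: "v k \<in> D" for k
    by (induction k) (simp_all add: v0 vSuc e subalgebra_mult[OF sub])
  have vn: "norm (v k) \<le> norm e ^ k" for k
  proof (induction k)
    case (Suc k)
    have "norm (v (Suc k)) \<le> norm e * norm (v k)" by (simp add: vSuc norm_mult_ineq)
    also have "\<dots> \<le> norm e * norm e ^ k" using Suc by (intro mult_left_mono) auto
    finally show ?case by simp
  qed (use \<open>norm e < 1\<close> in \<open>simp add: v0\<close>)
  have summ: "summable v"
    by (rule summable_comparison_test'[OF summable_geometric[of "norm e"], of 0])
      (use vn \<open>norm e < 1\<close> in auto)
  define s where "s = suminf v"
  have "(\<lambda>n. \<Sum>k<n. v k) \<longlonglongrightarrow> s"
    unfolding s_def using summ by (rule summable_LIMSEQ)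
  moreover have "(\<Sum>k<n. v k) \<in> D" for n
    by (intro complex_vector.subspace_sum[OF ss] vD)
  ultimately have s: "s \<in> D"
    using closed_sequentially[OF cl, of "\<lambda>n. \<Sum>k<n. v k" s] by simp
  have "e * s = (\<Sum>k. v (Suc k))"
    unfolding s_def vSuc by (rule suminf_mult[OF summ, symmetric])
  also have "\<dots> = s - e"
    using suminf_split_head[OF summ] by (simp add: s_def v0)
  finally have "s = e * s + e" by simp
  then have "x s = x e * x s + x e"
    using character_add[OF x, of "e * s" e] character_mult[OF x, of e s] s e
      subalgebra_mult[OF sub] by metis
  then show False using e by simp
qed

section \<open>Chains of matrix units\<close>

locale af_chain =
  fixes M :: "'c::cstar_algebra mu_chain"
  assumes regular: "regular_af_chain M"
begin

lemma munit_mult: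
  "(k, i, j) \<in> mu_index M n \<Longrightarrow> (k', i', j') \<in> mu_index M n \<Longrightarrow>
    munit M n k i j * munit M n k' i' j' = (if k = k' \<and> j = i' then munit M n k i j' else 0)"
  and star_munit: "(k, i, j) \<in> mu_index M n \<Longrightarrow> star (munit M n k i j) = munit M n k j i"
  and munit_nonzero: "(k, i, j) \<in> mu_index M n \<Longrightarrow> munit M n k i j \<noteq> 0"
  and matrix_unit_Suc: "e \<in> matrix_units M n \<Longrightarrow> \<exists>F\<subseteq>matrix_units M (Suc n). e = \<Sum>F"
  and closure_levels: "closure (\<Union>n. level_algebra M n) = UNIV"
  using regular unfolding regular_af_chain_def by blast+

lemma mu_index_swap: "(k, i, j) \<in> mu_index M n \<Longrightarrow> (k, j, i) \<in> mu_index M n"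
  and mu_index_comp:
    "(k, i, j) \<in> mu_index M n \<Longrightarrow> (k, i', j') \<in> mu_index M n \<Longrightarrow> (k, i, j') \<in> mu_index M n"
  by (simp_all add: mu_index_def)

lemma finite_mu_index: "finite (mu_index M n)"
proof -
  have "mu_index M n = (SIGMA k:{..<length (block_sizes M n)}.
      {..<block_sizes M n ! k} \<times> {..<block_sizes M n ! k})"
    by (auto simp: mu_index_def)
  then show ?thesis by simp
qed

lemma matrix_unitE:
  assumes "e \<in> matrix_units M n"
  obtains k i j where "(k, i, j) \<in> mu_index M n" "e = munit M n k i j"
  using assms by (auto simp: matrix_units_def)

lemma matrix_unitI: "(k, i, j) \<in> mu_index M n \<Longrightarrow> munit M n k i j \<in> matrix_units M n"
  by (auto simp: matrix_units_def)

lemma finite_matrix_units: "finite (matrix_units M n)"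
proof -
  have "matrix_units M n = (\<lambda>(k, i, j). munit M n k i j) ` mu_index M n"
    by (force simp: matrix_units_def)
  then show ?thesis using finite_mu_index by simp
qed

definition diagonal_units :: "nat \<Rightarrow> 'c set" where
  "diagonal_units n = {munit M n k i i | k i. (k, i, i) \<in> mu_index M n}"

lemma level_diagonal_span: "level_diagonal M n = complex_vector.span (diagonal_units n)"
  by (simp add: level_diagonal_def diagonal_units_def)

lemma diagonal_unitE:
  assumes "p \<in> diagonal_units n"
  obtains k i where "(k, i, i) \<in> mu_index M n" "p = munit M n k i i"
  using assms by (auto simp: diagonal_units_def)

lemma diagonal_unit_matrix_unit: "p \<in> diagonal_units n \<Longrightarrow> p \<in> matrix_units M n"
  by (auto simp: diagonal_units_def matrix_units_def)

lemma star_diagonal_unit: "p \<in> diagonal_units n \<Longrightarrow> star p = p"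
  and diagonal_unit_idem: "p \<in> diagonal_units n \<Longrightarrow> p * p = p"
  by (auto elim!: diagonal_unitE simp: star_munit munit_mult)

lemma star_matrix_unit: "e \<in> matrix_units M n \<Longrightarrow> star e \<in> matrix_units M n"
  by (elim matrix_unitE) (simp add: star_munit matrix_unitI mu_index_swap)

lemma matrix_unit_nonzero: "e \<in> matrix_units M n \<Longrightarrow> e \<noteq> 0"
  by (auto elim!: matrix_unitE simp: munit_nonzero)

lemma range_projection_diagonal: "e \<in> matrix_units M n \<Longrightarrow> e * star e \<in> diagonal_units n"
proof (elim matrix_unitE)
  fix k i j
  assume ij: "(k, i, j) \<in> mu_index M n" and e: "e = munit M n k i j"
  have "(k, i, i) \<in> mu_index M n" using ij mu_index_comp mu_index_swap by blast
  moreover have "e * star e = munit M n k i i"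
    using ij mu_index_swap[OF ij] by (simp add: e star_munit munit_mult)
  ultimately show "e * star e \<in> diagonal_units n"
    unfolding diagonal_units_def by blast
qed

lemma source_projection_diagonal: "e \<in> matrix_units M n \<Longrightarrow> star e * e \<in> diagonal_units n"
  using range_projection_diagonal[OF star_matrix_unit, of e] by simp

lemma matrix_unit_partial_isometry: "e \<in> matrix_units M n \<Longrightarrow> e * star e * e = e"
proof (elim matrix_unitE)
  fix k i j
  assume ij: "(k, i, j) \<in> mu_index M n" and e: "e = munit M n k i j"
  have "(k, i, i) \<in> mu_index M n" using ij mu_index_comp mu_index_swap by blast
  then show "e * star e * e = e"
    using ij mu_index_swap[OF ij] by (simp add: e star_munit munit_mult)
qed

lemma munit_eq_iff:
  assumes "(k, i, j) \<in> mu_index M n" "(k', i', j') \<in> mu_index M n"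
  shows "munit M n k i j = munit M n k' i' j' \<longleftrightarrow> k = k' \<and> i = i' \<and> j = j'"
proof
  assume eq: "munit M n k i j = munit M n k' i' j'"
  have ii: "(k, i, i) \<in> mu_index M n" and jj: "(k, j, j) \<in> mu_index M n"
    using assms(1) mu_index_comp mu_index_swap by blast+
  have "munit M n k i i * munit M n k' i' j' \<noteq> 0"
    using munit_mult[OF ii assms(1)] munit_nonzero[OF assms(1)] eq by simp
  moreover have "munit M n k' i' j' * munit M n k j j \<noteq> 0"
    using munit_mult[OF assms(1) jj] munit_nonzero[OF assms(1)] eq by simp
  ultimately show "k = k' \<and> i = i' \<and> j = j'"
    using munit_mult[OF ii assms(2)] munit_mult[OF assms(2) jj] by (auto split: if_splits)
qed auto

lemma diagonal_units_mult:
  assumes "p \<in> diagonal_units n" "q \<in> diagonal_units n"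
  shows "p * q = (if p = q then p else 0)"
  using assms by (elim diagonal_unitE) (auto simp: munit_mult munit_eq_iff)

lemma diagonal_unit_mult_matrix_unit:
  assumes "p \<in> diagonal_units n" "e \<in> matrix_units M n"
  shows "p * e = (if p = e * star e then e else 0)"
proof -
  have "p * e = p * (e * star e) * e"
    using matrix_unit_partial_isometry[OF assms(2)] by (simp add: mult.assoc)
  then show ?thesis
    using diagonal_units_mult[OF assms(1) range_projection_diagonal[OF assms(2)]]
      matrix_unit_partial_isometry[OF assms(2)] by auto
qed

lemma matrix_unit_mult_diagonal_unit:
  assumes "p \<in> diagonal_units n" "e \<in> matrix_units M n"
  shows "e * p = (if p = star e * e then e else 0)"
proof -
  have "e * p = star (p * star e)"
    by (simp add: star_mult star_diagonal_unit[OF assms(1)])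
  then show ?thesis
    using diagonal_unit_mult_matrix_unit[OF assms(1) star_matrix_unit[OF assms(2)]] by auto
qed

text \<open>Within a level, range and source projection play the part of row and column index. Later
  arguments identify matrix units in this form, without returning to indices.\<close>

lemma matrix_unit_eqI:
  assumes "e \<in> matrix_units M n" "f \<in> matrix_units M n"
    and "e * star e = f * star f" "star e * e = star f * f"
  shows "e = f"
  using assms
proof (elim matrix_unitE)
  fix k i j k' i' j'
  assume ij: "(k, i, j) \<in> mu_index M n" "(k', i', j') \<in> mu_index M n"
    and e: "e = munit M n k i j" "f = munit M n k' i' j'"
  have idx: "(k, i, i) \<in> mu_index M n" "(k, j, j) \<in> mu_index M n"
    "(k', i', i') \<in> mu_index M n" "(k', j', j') \<in> mu_index M n"
    using ij mu_index_comp mu_index_swap by blast+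
  have "munit M n k i i = munit M n k' i' i'" "munit M n k j j = munit M n k' j' j'"
    using assms(3,4) ij by (simp_all add: e star_munit munit_mult mu_index_swap)
  then show ?thesis using idx by (simp add: e munit_eq_iff)
qed

lemma matrix_units_mult_eq_0:
  assumes "e \<in> matrix_units M n" "f \<in> matrix_units M n" "star e * e \<noteq> f * star f"
  shows "e * f = 0"
proof -
  have "e * f = e * (f * star f) * f"
    using matrix_unit_partial_isometry[OF assms(2)] by (simp add: mult.assoc)
  also have "e * (f * star f) = 0"
    using matrix_unit_mult_diagonal_unit[OF range_projection_diagonal[OF assms(2)] assms(1)] assms(3)
    by auto
  finally show ?thesis by simp
qed

section \<open>Norms of matrix units and their decomposition at deeper levels\<close>

lemma norm_matrix_unit: "e \<in> matrix_units M n \<Longrightarrow> norm e = 1"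
proof -
  assume e: "e \<in> matrix_units M n"
  note p = source_projection_diagonal[OF e]
  have "norm (star e * e) = 1"
    using p by (intro norm_projection_eq_1)
      (auto simp: star_diagonal_unit diagonal_unit_idem
        dest: diagonal_unit_matrix_unit matrix_unit_nonzero)
  then show "norm e = 1"
    by (simp add: cstar_identity abs_square_eq_1)
qed

text \<open>If two summands shared a column, the sum would map a unit vector to one of norm at least
  \<open>sqrt 2\<close>.\<close>

lemma contractive_sum_matrix_units_column:
  assumes F: "F \<subseteq> matrix_units M n" and norm: "norm (\<Sum>F) \<le> 1"
    and fg: "f \<in> F" "g \<in> F" "star f * f = star g * g"
  shows "f = g"
proof -
  have finF: "finite F" using F finite_matrix_units finite_subset by blast
  define q where "q = star f * f"
  have q: "q \<in> diagonal_units n" unfolding q_def using F fg source_projection_diagonal by blast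
  define H where "H = {h \<in> F. star h * h = q}"
  have finH: "finite H" using finF by (simp add: H_def)
  have HF: "H \<subseteq> matrix_units M n" using F by (auto simp: H_def)
  have "\<Sum>F * q = (\<Sum>h\<in>F. if star h * h = q then h else 0)"
    unfolding sum_distrib_right
    by (intro sum.cong refl) (use F matrix_unit_mult_diagonal_unit[OF q] in auto)
  also have "\<dots> = \<Sum>H"
    using finF by (simp add: H_def sum.If_cases Int_def)
  finally have Fq: "\<Sum>F * q = \<Sum>H" .
  have "star h * h' = (if h = h' then q else 0)" if h: "h \<in> H" "h' \<in> H" for h h'
  proof (cases "h = h'")
    case False
    then have "h * star h \<noteq> h' * star h'"
      using h HF matrix_unit_eqI[of h n h'] by (auto simp: H_def)
    then have "star h * h' = 0"
      using h HF matrix_units_mult_eq_0[OF star_matrix_unit, of h n h'] by auto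
    then show ?thesis using False by simp
  qed (use h in \<open>simp add: H_def\<close>)
  then have "star (\<Sum>H) * \<Sum>H = (\<Sum>h\<in>H. \<Sum>h'\<in>H. if h = h' then q else 0)"
    by (simp add: star.sum sum_product)
  also have "\<dots> = real (card H) *\<^sub>R q"
    using finH by (simp add: scaleR_conv_of_real sum_constant_scaleR)
  finally have "(norm (\<Sum>H))\<^sup>2 = real (card H)"
    using cstar_identity[of "\<Sum>H"] norm_matrix_unit[OF diagonal_unit_matrix_unit[OF q]] by simp
  moreover have "norm (\<Sum>H) \<le> 1"
    unfolding Fq[symmetric] using norm norm_matrix_unit[OF diagonal_unit_matrix_unit[OF q]]
    by (intro norm_mult_le_1) auto
  ultimately have "card H \<le> 1"
    using power_le_one[of "norm (\<Sum>H)" 2] by simp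
  moreover have "f \<in> H" "g \<in> H" using fg by (simp_all add: H_def q_def)
  ultimately show ?thesis
    using finH card_le_Suc0_iff_eq[of H] by simp
qed

text \<open>Regularity of the chain provides sums of matrix units but says nothing about
  orthogonality of the summands; the norm bound supplies it. The preceding lemma excludes shared
  columns and, applied to the adjoints, shared rows.\<close>

lemma contractive_sum_matrix_units_orthogonal:
  assumes F: "F \<subseteq> matrix_units M n" and norm: "norm (\<Sum>F) \<le> 1"
    and fg: "f \<in> F" "g \<in> F" "f \<noteq> g"
  shows "f * star g = 0" "star f * g = 0"
proof -
  have fu: "f \<in> matrix_units M n" and gu: "g \<in> matrix_units M n"
    using F fg by auto
  have "star f * f \<noteq> star g * g"
    using contractive_sum_matrix_units_column[OF F norm] fg by blast
  then show "f * star g = 0"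
    using matrix_units_mult_eq_0[OF fu star_matrix_unit[OF gu]] by simp
  have "(\<Sum>h\<in>star ` F. h) = star (\<Sum>F)"
    by (subst sum.reindex) (auto simp: star.sum inj_on_def dest: arg_cong[of _ _ star])
  then have "norm (\<Sum>(star ` F)) \<le> 1" using norm by simp
  moreover have "star ` F \<subseteq> matrix_units M n" using F star_matrix_unit by blast
  moreover have "star f \<noteq> star g" using fg(3) by (metis star_star)
  ultimately have "f * star f \<noteq> g * star g"
    using contractive_sum_matrix_units_column[of "star ` F" n "star f" "star g"] fg by auto
  then show "star f * g = 0"
    using matrix_units_mult_eq_0[OF star_matrix_unit[OF fu] gu] by simp
qed

lemma contractive_sum_matrix_units_corner:
  assumes F: "F \<subseteq> matrix_units M n" and norm: "norm (\<Sum>F) \<le> 1" and f: "f \<in> F"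
  shows "f * star f * \<Sum>F = f" "\<Sum>F * (star f * f) = f"
proof -
  have finF: "finite F" using F finite_matrix_units finite_subset by blast
  have pi: "f * star f * f = f" using F f matrix_unit_partial_isometry by blast
  have "f * star f * \<Sum>F = (\<Sum>g\<in>F. f * (star f * g))"
    by (simp add: sum_distrib_left mult.assoc)
  also have "\<dots> = (\<Sum>g\<in>F. if f = g then f * (star f * f) else 0)"
    using contractive_sum_matrix_units_orthogonal[OF F norm f] by (intro sum.cong) auto
  finally show "f * star f * \<Sum>F = f" using finF f pi by (simp add: mult.assoc)
  have "\<Sum>F * (star f * f) = (\<Sum>g\<in>F. (g * star f) * f)"
    by (simp add: sum_distrib_right mult.assoc)
  also have "\<dots> = (\<Sum>g\<in>F. if f = g then (f * star f) * f else 0)"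
    using contractive_sum_matrix_units_orthogonal[OF F norm _ f] by (intro sum.cong) auto
  finally show "\<Sum>F * (star f * f) = f" using finF f pi by simp
qed

text \<open>By induction on the level, each summand is replaced by its own decomposition. The point
  is that these are disjoint, so that their union has the right sum: an \<open>h\<close> common to
  \<open>G f\<close> and \<open>G g\<close> would equal \<open>g * star g * f * star f * h\<close>,
  which vanishes because \<open>star g * f = 0\<close>.\<close>

lemma matrix_unit_decomposition:
  assumes e: "e \<in> matrix_units M n" and "n \<le> m"
  obtains F where "F \<subseteq> matrix_units M m" "e = \<Sum>F"
proof -
  from \<open>n \<le> m\<close> have "\<exists>F\<subseteq>matrix_units M m. e = \<Sum>F"
  proof (induction m rule: dec_induct)
    case base
    show ?case using e by (intro exI[of _ "{e}"]) auto
  next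
    case (step m)
    then obtain F where F: "F \<subseteq> matrix_units M m" and eF: "e = \<Sum>F" by blast
    have norm: "norm (\<Sum>F) \<le> 1" using norm_matrix_unit[OF e] eF by simp
    have finF: "finite F" using F finite_matrix_units finite_subset by blast
    have "\<forall>f\<in>F. \<exists>G\<subseteq>matrix_units M (Suc m). f = \<Sum>G"
      using F matrix_unit_Suc by blast
    then obtain G where G: "\<And>f. f \<in> F \<Longrightarrow> G f \<subseteq> matrix_units M (Suc m)"
      and fG: "\<And>f. f \<in> F \<Longrightarrow> f = \<Sum>(G f)"
      by metis
    have absorb: "f * star f * h = h" if "f \<in> F" "h \<in> G f" for f h
    proof -
      have f: "f \<in> matrix_units M m" using F that by blast
      have "norm (\<Sum>(G f)) \<le> 1" using norm_matrix_unit[OF f] fG[OF that(1)] by simp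
      then have h: "f * (star h * h) = h"
        using contractive_sum_matrix_units_corner(2)[OF G[OF that(1)] _ that(2)] fG[OF that(1)]
        by simp
      have "f * star f * (f * (star h * h)) = f * (star h * h)"
        using matrix_unit_partial_isometry[OF f] by (simp add: mult.assoc[symmetric])
      then show ?thesis by (simp add: h)
    qed
    have "G f \<inter> G g = {}" if fg: "f \<in> F" "g \<in> F" "f \<noteq> g" for f g
    proof (rule ccontr)
      assume "G f \<inter> G g \<noteq> {}"
      then obtain h where h: "h \<in> G f" "h \<in> G g" by blast
      have "h = g * (star g * f) * (star f * h)"
        using absorb[OF fg(1) h(1)] absorb[OF fg(2) h(2)] by (simp add: mult.assoc)
      also have "star g * f = 0"
        using contractive_sum_matrix_units_orthogonal[OF F norm fg(2,1)] fg(3) by auto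
      finally show False using matrix_unit_nonzero[of h "Suc m"] G[OF fg(1)] h by auto
    qed
    moreover have "finite (G f)" if "f \<in> F" for f
      using G[OF that] finite_matrix_units finite_subset by blast
    ultimately have "\<Sum>(\<Union>f\<in>F. G f) = (\<Sum>f\<in>F. \<Sum>(G f))"
      using finF by (intro sum.UNION_disjoint) auto
    also have "\<dots> = e" unfolding eF by (intro sum.cong refl fG[symmetric])
    finally have "e = \<Sum>(\<Union>f\<in>F. G f)" ..
    then show ?case using G by (intro exI[of _ "\<Union>f\<in>F. G f"]) auto
  qed
  then show ?thesis using that by blast
qed

lemma level_algebra_mono:
  assumes "n \<le> m" shows "level_algebra M n \<subseteq> level_algebra M m"
  unfolding level_algebra_def
proof (rule complex_vector.span_minimal)
  show "matrix_units M n \<subseteq> complex_vector.span (matrix_units M m)"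
  proof
    fix e assume "e \<in> matrix_units M n"
    then obtain F where F: "F \<subseteq> matrix_units M m" and e: "e = \<Sum>F"
      using matrix_unit_decomposition[OF _ assms] by blast
    show "e \<in> complex_vector.span (matrix_units M m)"
      unfolding e using F by (intro complex_vector.span_sum complex_vector.span_base) blast
  qed
qed (rule complex_vector.subspace_span)

lemma range_projection_sum:
  assumes F: "F \<subseteq> matrix_units M n" and norm: "norm (\<Sum>F) \<le> 1"
  shows "\<Sum>F * star (\<Sum>F) = (\<Sum>f\<in>F. f * star f)"
proof -
  have finF: "finite F" using F finite_matrix_units finite_subset by blast
  have "\<Sum>F * star (\<Sum>F) = (\<Sum>f\<in>F. \<Sum>g\<in>F. f * star g)"
    by (simp add: star.sum sum_product)
  also have "\<dots> = (\<Sum>f\<in>F. \<Sum>g\<in>F. if f = g then f * star f else 0)"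
    using contractive_sum_matrix_units_orthogonal[OF F norm] by (intro sum.cong refl) auto
  finally show ?thesis using finF by simp
qed

text \<open>The summands of \<open>d\<close> at level \<open>m\<close> are not themselves shown to
  be diagonal. Writing \<open>d\<close> as \<open>d * star d\<close> replaces them by their range
  projections, which are.\<close>

lemma diagonal_unit_in_level_diagonal:
  assumes d: "d \<in> diagonal_units n" and "n \<le> m"
  shows "d \<in> level_diagonal M m"
proof -
  note du = diagonal_unit_matrix_unit[OF d]
  obtain F where F: "F \<subseteq> matrix_units M m" "d = \<Sum>F"
    using matrix_unit_decomposition[OF du \<open>n \<le> m\<close>] by blast
  have "d = d * star d" using d by (simp add: star_diagonal_unit diagonal_unit_idem)
  also have "\<dots> = (\<Sum>f\<in>F. f * star f)"
    using range_projection_sum[OF F(1)] norm_matrix_unit[OF du] F(2) by simp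
  also have "\<dots> \<in> level_diagonal M m"
    unfolding level_diagonal_span
    using F(1) range_projection_diagonal
    by (intro complex_vector.span_sum complex_vector.span_base) blast
  finally show ?thesis .
qed

lemma level_diagonal_mono:
  assumes "n \<le> m" shows "level_diagonal M n \<subseteq> level_diagonal M m"
  unfolding level_diagonal_span[of n]
  by (rule complex_vector.span_minimal)
    (auto simp: level_diagonal_span[of m] complex_vector.subspace_span
      intro: diagonal_unit_in_level_diagonal[OF _ assms, unfolded level_diagonal_span])

text \<open>Matrix units normalise the diagonal: \<open>u * d\<close> is the sum of those summands
  of \<open>u\<close> whose source is \<open>d\<close>, and \<open>u * d * star u\<close> is the sum
  of their range projections.\<close>

lemma conjugate_diagonal_unit:
  assumes u: "u \<in> matrix_units M n" and d: "d \<in> diagonal_units m" and "n \<le> m"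
  shows "u * d * star u \<in> level_diagonal M m"
proof -
  obtain F where F: "F \<subseteq> matrix_units M m" "u = \<Sum>F"
    using matrix_unit_decomposition[OF u \<open>n \<le> m\<close>] by blast
  have norm: "norm (\<Sum>F) \<le> 1" using F(2) norm_matrix_unit[OF u] by simp
  have finF: "finite F" using F finite_matrix_units finite_subset by blast
  define H where "H = {f \<in> F. star f * f = d}"
  have "u * d = (\<Sum>f\<in>F. if star f * f = d then f else 0)"
    unfolding F(2) sum_distrib_right
    by (intro sum.cong refl) (use F(1) matrix_unit_mult_diagonal_unit[OF d] in auto)
  also have "\<dots> = \<Sum>H" using finF by (simp add: H_def sum.If_cases Int_def)
  finally have ud: "u * d = \<Sum>H" .
  have "norm (u * d) \<le> 1"
    using norm_matrix_unit[OF u] norm_matrix_unit[OF diagonal_unit_matrix_unit[OF d]]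
    by (intro norm_mult_le_1) auto
  then have normH: "norm (\<Sum>H) \<le> 1" by (simp add: ud)
  have "u * d * star u = (u * d) * star (u * d)"
    using d by (simp add: star_mult star_diagonal_unit mult.assoc)
      (metis diagonal_unit_idem mult.assoc)
  also have "\<dots> = (\<Sum>f\<in>H. f * star f)"
    unfolding ud using F(1) by (intro range_projection_sum normH) (auto simp: H_def)
  also have "\<dots> \<in> level_diagonal M m"
    unfolding level_diagonal_span using F(1) range_projection_diagonal
    by (intro complex_vector.span_sum complex_vector.span_base) (auto simp: H_def)
  finally show ?thesis .
qed

text \<open>A corner of a direct sum of matrix algebras cut by two minimal diagonal projections is
  spanned by the matrix unit joining them, or is zero if they lie in different summands;
  \<open>nz\<close> excludes the latter.\<close>

lemma matrix_algebra_corner: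
  assumes p: "p \<in> diagonal_units n" and q: "q \<in> diagonal_units n" and b: "b \<in> level_algebra M n"
    and nz: "p * b * q \<noteq> 0"
  obtains u \<beta> where "u \<in> matrix_units M n" "u * star u = p" "star u * u = q" "p * b * q = \<beta> *\<^sub>C u"
proof -
  have corner: "p * e * q = (if e * star e = p \<and> star e * e = q then e else 0)"
    if "e \<in> matrix_units M n" for e
    using diagonal_unit_mult_matrix_unit[OF p that] matrix_unit_mult_diagonal_unit[OF q that]
    by auto
  have "\<exists>u\<in>matrix_units M n. u * star u = p \<and> star u * u = q"
  proof (rule ccontr)
    assume none: "\<not> ?thesis"
    have "level_algebra M n \<subseteq> {b. p * b * q = 0}"
      unfolding level_algebra_def
    proof (rule complex_vector.span_minimal)
      show "matrix_units M n \<subseteq> {b. p * b * q = 0}"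
        using corner none by auto
      show "complex_vector.subspace {b. p * b * q = 0}"
        by (auto simp: complex_vector.subspace_def distrib_left distrib_right
            scaleC_mult_left scaleC_mult_right)
    qed
    with b nz show False by blast
  qed
  then obtain u where u: "u \<in> matrix_units M n" "u * star u = p" "star u * u = q" by blast
  have "level_algebra M n \<subseteq> {b. \<exists>\<beta>. p * b * q = \<beta> *\<^sub>C u}"
    unfolding level_algebra_def
  proof (rule complex_vector.span_minimal)
    have "\<exists>\<beta>. p * e * q = \<beta> *\<^sub>C u" if e: "e \<in> matrix_units M n" for e
    proof (cases "e * star e = p \<and> star e * e = q")
      case True
      then have "e = u" using matrix_unit_eqI[OF e u(1)] u by simp
      then show ?thesis using corner[OF e] True by (intro exI[of _ 1]) (simp add: scaleC_one)
    next
      case False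
      then show ?thesis using corner[OF e] by (intro exI[of _ 0]) auto
    qed
    then show "matrix_units M n \<subseteq> {b. \<exists>\<beta>. p * b * q = \<beta> *\<^sub>C u}" by blast
    show "complex_vector.subspace {b. \<exists>\<beta>. p * b * q = \<beta> *\<^sub>C u}"
      by (auto simp: complex_vector.subspace_def distrib_left distrib_right scaleC_mult_left scaleC_mult_right)
        (metis scaleC_add_left)
  qed
  then obtain \<beta> where "p * b * q = \<beta> *\<^sub>C u" using b by blast
  then show ?thesis using that u by blast
qed

lemma level_approximation:
  assumes "0 < \<eta>"
  obtains m b where "n \<le> m" "b \<in> level_algebra M m" "norm (a - b) < \<eta>"
proof -
  have "a \<in> closure (\<Union>n. level_algebra M n)" using closure_levels by simp
  then obtain k b where "b \<in> level_algebra M k" "dist b a < \<eta>"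
    using assms by (auto simp: closure_approachable)
  then show ?thesis
    using that[of "max n k" b] level_algebra_mono[of k "max n k"]
    by (auto simp: dist_norm norm_minus_commute)
qed

end

section \<open>Fundamental relations of triangular algebras\<close>

lemma norm_corner_le:
  fixes p q c :: "'a::real_normed_algebra"
  assumes "norm p \<le> 1" "norm q \<le> 1" "norm c \<le> k"
  shows "norm (p * c * q) \<le> k"
  by (rule norm_mult_le_1(2)[OF assms(2) norm_mult_le_1(1)[OF assms(1,3)]])

lemma graph_of_iff:
  "(x, y) \<in> graph_of D e \<longleftrightarrow>
    x \<in> characters D \<and> x (e * star e) = 1 \<and> y = (\<lambda>d\<in>D. x (e * d * star e))"
  by (auto simp: graph_of_def support_def)

text \<open>Contractions in \<open>D\<close> with value 1 at a character serve as shrinking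
  neighbourhoods of it. Heuristically, the best \<epsilon> is the modulus of the entry of
  \<open>a\<close> in row \<open>x\<close> and column \<open>y\<close>.\<close>

definition corner_bound ::
    "'c::cstar_algebra set \<Rightarrow> 'c \<Rightarrow> ('c \<Rightarrow> complex) \<Rightarrow> ('c \<Rightarrow> complex) \<Rightarrow> real \<Rightarrow> bool" where
  "corner_bound D a x y \<epsilon> \<longleftrightarrow>
     (\<forall>p\<in>D. \<forall>q\<in>D. norm p \<le> 1 \<longrightarrow> norm q \<le> 1 \<longrightarrow> x p = 1 \<longrightarrow> y q = 1 \<longrightarrow> \<epsilon> \<le> norm (p * a * q))"

text \<open>This set refers only to the norm and the algebra structure, so it is carried along by isometric
  isomorphisms; for a matrix unit \<open>e\<close> of a triangular limit algebra it is the graph of \<open>e\<close>.\<close>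

definition essential_support ::
    "'c::cstar_algebra set \<Rightarrow> 'c \<Rightarrow> (('c \<Rightarrow> complex) \<times> ('c \<Rightarrow> complex)) set" where
  "essential_support D a =
     {(x, y). x \<in> characters D \<and> y \<in> characters D \<and> (\<exists>\<epsilon>>0. corner_bound D a x y \<epsilon>)}"

lemma openin_topology_generated_by_coarser:
  assumes "openin (topology_generated_by S) U" "\<And>s. s \<in> S \<Longrightarrow> openin T s"
  shows "openin T U"
  using generate_topology_on_coarsest[OF istopology_openin[of T], of S U] assms
  by (simp add: openin_topology_generated_by_iff)

definition indecomposable_pairs :: "('a \<times> 'a) set \<Rightarrow> ('a \<times> 'a) set" where
  "indecomposable_pairs R =
     {(x, z). (x, z) \<in> R \<and> x \<noteq> z \<and> \<not> (\<exists>y. (x, y) \<in> R \<and> (y, z) \<in> R \<and> x \<noteq> y \<and> y \<noteq> z)}"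

section \<open>The diagonal of a triangular algebra\<close>

locale triangular_algebra = af_chain M for M :: "'c::cstar_algebra mu_chain" +
  fixes A :: "'c set"
  assumes subalgebra_A: "subalgebra A" and closed_A: "closed A"
    and diagonal_eq: "A \<inter> star ` A = diagonal M"

lemma triangular_algebraI: "triangular_limit_algebra M A \<Longrightarrow> triangular_algebra M A"
  unfolding triangular_limit_algebra_def limit_algebra_def
  by unfold_locales blast+

context triangular_algebra
begin

abbreviation D where "D \<equiv> diagonal M"

lemma diagonal_subset: "D \<subseteq> A"
  using diagonal_eq by blast

lemma star_diagonal: "d \<in> D \<Longrightarrow> star d \<in> D"
  unfolding diagonal_eq[symmetric] by auto

lemma diagonalI: "a \<in> A \<Longrightarrow> star a = a \<Longrightarrow> a \<in> D"
  unfolding diagonal_eq[symmetric] by (metis IntI image_eqI)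

lemma closed_diagonal: "closed D"
  by (simp add: diagonal_def)

text \<open>Triangularity spares a limit argument: \<open>d\<close> is in \<open>D\<close> exactly
  when \<open>d\<close> and \<open>star d\<close> are in \<open>A\<close>, and this is stable under
  the operations.\<close>

lemma subalgebra_diagonal: "subalgebra D"
  unfolding subalgebra_def complex_vector.subspace_def
proof (intro conjI allI ballI)
  note ss = subalgebra_subspace[OF subalgebra_A]
  have iff: "d \<in> D \<longleftrightarrow> d \<in> A \<and> star d \<in> A" for d
    unfolding diagonal_eq[symmetric] by (metis IntE IntI image_iff star_star)
  show "0 \<in> D" using complex_vector.subspace_0[OF ss] by (simp add: iff)
  show "x + y \<in> D" if "x \<in> D" "y \<in> D" for x y
    using that complex_vector.subspace_add[OF ss] by (simp add: iff star_add)
  show "c *\<^sub>C x \<in> D" if "x \<in> D" for c x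
    using that complex_vector.subspace_scale[OF ss] by (simp add: iff star_scaleC)
  show "x * y \<in> D" if "x \<in> D" "y \<in> D" for x y
    using that subalgebra_mult[OF subalgebra_A] by (simp add: iff star_mult)
qed

lemmas subspace_D = subalgebra_subspace[OF subalgebra_diagonal]
lemmas mult_D = subalgebra_mult[OF subalgebra_diagonal]
lemmas diff_D = complex_vector.subspace_diff[OF subspace_D]
lemmas mult_A = subalgebra_mult[OF subalgebra_A]

lemma corner_A: "p \<in> D \<Longrightarrow> a \<in> A \<Longrightarrow> q \<in> D \<Longrightarrow> p * a * q \<in> A"
  using diagonal_subset mult_A by blast

lemma level_diagonal_subset: "level_diagonal M n \<subseteq> D"
  unfolding diagonal_def by (meson SUP_upper UNIV_I closure_subset order_trans)

lemma diagonal_unit_in_D: "p \<in> diagonal_units n \<Longrightarrow> p \<in> D"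
  using level_diagonal_subset diagonal_unit_in_level_diagonal by blast

text \<open>Induction principle for the diagonal. Checking levels from \<open>n\<close> on is enough
  because the level diagonals increase; this leaves room for a fixed matrix unit of level
  \<open>n\<close>, which has to be decomposed at the level of the diagonal units.\<close>

lemma diagonal_subsetI:
  assumes "closed S" and "complex_vector.subspace S" and "\<And>m. n \<le> m \<Longrightarrow> diagonal_units m \<subseteq> S"
  shows "D \<subseteq> S"
  unfolding diagonal_def
proof (rule closure_minimal[OF _ assms(1)], rule UN_least)
  fix m
  have "level_diagonal M m \<subseteq> level_diagonal M (max n m)"
    by (rule level_diagonal_mono) simp
  also have "\<dots> \<subseteq> S"
    unfolding level_diagonal_span using assms(2,3) by (intro complex_vector.span_minimal) auto
  finally show "level_diagonal M m \<subseteq> S" .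
qed

text \<open>Two passes of the induction principle: diagonal units of a common level commute, hence a
  diagonal unit commutes with all of \<open>D\<close>, hence \<open>D\<close> commutes with
  itself.\<close>

lemma diagonal_commute:
  assumes "d \<in> D" "e \<in> D" shows "d * e = e * d"
proof -
  have closed_comm: "closed {d. d * e = e * d}" for e :: 'c
    by (intro closed_Collect_eq continuous_intros)
  have subspace_comm: "complex_vector.subspace {d. d * e = e * d}" for e :: 'c
    by (auto simp: complex_vector.subspace_def distrib_left distrib_right
        scaleC_mult_left scaleC_mult_right)
  have units_comm: "p * q = q * p" if "p \<in> diagonal_units m" "q \<in> diagonal_units m" for p q m
    using diagonal_units_mult[OF that] diagonal_units_mult[OF that(2,1)] by auto
  have "D \<subseteq> {d. d * q = q * d}" if q: "q \<in> diagonal_units n" for q n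
  proof (rule diagonal_subsetI[OF closed_comm subspace_comm])
    fix m assume "n \<le> m"
    then have "q \<in> level_diagonal M m" by (rule diagonal_unit_in_level_diagonal[OF q])
    moreover have "level_diagonal M m \<subseteq> {q. q * p = p * q}" if "p \<in> diagonal_units m" for p
      unfolding level_diagonal_span
      using units_comm that by (intro complex_vector.span_minimal subspace_comm) auto
    ultimately have "q * p = p * q" if "p \<in> diagonal_units m" for p using that by blast
    then show "diagonal_units m \<subseteq> {d. d * q = q * d}" by (simp add: subset_iff)
  qed
  then have "q * d = d * q" if "q \<in> diagonal_units n" for q n
    using that assms(1) by fastforce
  then have "D \<subseteq> {e. e * d = d * e}"
    by (intro diagonal_subsetI[where n=0, OF closed_comm subspace_comm]) auto
  then show ?thesis using assms(2) by auto
qed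

lemma conjugate_diagonal:
  assumes u: "u \<in> matrix_units M n" and d: "d \<in> D"
  shows "u * d * star u \<in> D"
proof -
  have "D \<subseteq> {d. u * d * star u \<in> D}"
  proof (rule diagonal_subsetI[where n=n])
    have "closed ((\<lambda>d. u * d * star u) -` D)"
      by (intro continuous_closed_vimage closed_diagonal continuous_intros)
    then show "closed {d. u * d * star u \<in> D}" by (simp add: vimage_def)
    show "complex_vector.subspace {d. u * d * star u \<in> D}"
      using complex_vector.subspace_0[OF subspace_D] complex_vector.subspace_add[OF subspace_D]
        complex_vector.subspace_scale[OF subspace_D]
      by (auto simp: complex_vector.subspace_def distrib_left distrib_right
          scaleC_mult_left scaleC_mult_right)
    show "diagonal_units m \<subseteq> {d. u * d * star u \<in> D}" if "n \<le> m" for m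
      using conjugate_diagonal_unit[OF u _ that] level_diagonal_subset by blast
  qed
  then show ?thesis using d by blast
qed

lemma projections_in_D:
  assumes "u \<in> matrix_units M n"
  shows "u * star u \<in> D" "star u * u \<in> D"
  using assms range_projection_diagonal source_projection_diagonal diagonal_unit_in_D by blast+

text \<open>Characters are meaningful on \<open>D\<close> only, so linearity and boundedness are
  required there alone; the bound makes the zero set closed.\<close>

lemma linear_functional_diagonal_eq_0:
  fixes \<phi> :: "'c \<Rightarrow> complex"
  assumes add: "\<And>a b. a \<in> D \<Longrightarrow> b \<in> D \<Longrightarrow> \<phi> (a + b) = \<phi> a + \<phi> b"
    and scale: "\<And>c a. a \<in> D \<Longrightarrow> \<phi> (c *\<^sub>C a) = c * \<phi> a"
    and bound: "\<And>a. a \<in> D \<Longrightarrow> cmod (\<phi> a) \<le> K * norm a" and K: "0 < K"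
    and zero: "\<And>m p. n \<le> m \<Longrightarrow> p \<in> diagonal_units m \<Longrightarrow> \<phi> p = 0"
    and d: "d \<in> D"
  shows "\<phi> d = 0"
proof -
  have "D \<subseteq> {d \<in> D. \<phi> d = 0}"
  proof (rule diagonal_subsetI[where n=n])
    show "complex_vector.subspace {d \<in> D. \<phi> d = 0}"
      using subspace_D add scale scale[of 0 0] by (auto simp: complex_vector.subspace_def)
    show "diagonal_units m \<subseteq> {d \<in> D. \<phi> d = 0}" if "n \<le> m" for m
      using zero[OF that] diagonal_unit_in_D by blast
    show "closed {d \<in> D. \<phi> d = 0}"
      unfolding closed_sequential_limits
    proof (intro allI impI)
      fix X l
      assume "(\<forall>k. X k \<in> {d \<in> D. \<phi> d = 0}) \<and> X \<longlonglongrightarrow> l"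
      then have X: "\<And>k. X k \<in> D" "\<And>k. \<phi> (X k) = 0" and lim: "X \<longlonglongrightarrow> l" by auto
      have l: "l \<in> D" using closed_sequentially[OF closed_diagonal _ lim] X by blast
      have "cmod (\<phi> l) \<le> K * norm (l - X k)" for k
        using add[OF diff_D[OF l X(1)] X(1), of k k] X(2)[of k] bound[OF diff_D[OF l X(1)], of k]
        by simp
      moreover have "(\<lambda>k. K * norm (l - X k)) \<longlonglongrightarrow> K * norm (l - l)"
        by (intro tendsto_intros lim)
      ultimately have "cmod (\<phi> l) \<le> K * norm (l - l)"
        by (intro LIMSEQ_le_const) auto
      then show "l \<in> {d \<in> D. \<phi> d = 0}" using l by simp
    qed
  qed
  then show ?thesis using d by blast
qed

lemmas character_le = character_norm_le[OF subalgebra_diagonal closed_diagonal]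

lemma character_idempotent:
  assumes "x \<in> characters D" "p \<in> D" "p * p = p"
  shows "x p = 0 \<or> x p = 1"
  using character_mult[OF assms(1,2,2)] assms(3) by (metis mult_cancel_right1)

text \<open>Diagonal units span a dense subspace, so a nonzero character is nonzero on one of them.
  \<open>D\<close> need not have a unit, so low levels may fail; all deeper levels succeed because
  the diagonal unit found is a combination of deeper ones.\<close>

lemma character_diagonal_unit:
  assumes x: "x \<in> characters D"
  obtains n where "\<forall>m\<ge>n. \<exists>p\<in>diagonal_units m. x p = 1"
proof -
  obtain a where a: "a \<in> D" "x a \<noteq> 0" using character_nonzero[OF x] by blast
  have lin: "x (b + c) = x b + x c" "x (\<gamma> *\<^sub>C b) = \<gamma> * x b" if "b \<in> D" "c \<in> D" for b c \<gamma>
    using x that by (auto simp: character_add character_scaleC)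
  have "\<exists>n. \<exists>p\<in>diagonal_units n. x p \<noteq> 0"
  proof (rule ccontr)
    assume none: "\<not> ?thesis"
    have "x a = 0"
      by (rule linear_functional_diagonal_eq_0[where \<phi>=x and K=1 and n=0])
        (use x a none character_le[OF x] in \<open>auto simp: character_add character_scaleC\<close>)
    with a show False by simp
  qed
  then obtain n p where p: "p \<in> diagonal_units n" "x p \<noteq> 0" by blast
  have "\<exists>q\<in>diagonal_units m. x q = 1" if "n \<le> m" for m
  proof (rule ccontr)
    assume "\<not> ?thesis"
    then have "x q = 0" if "q \<in> diagonal_units m" for q
      using character_idempotent[OF x diagonal_unit_in_D[OF that] diagonal_unit_idem[OF that]] that
      by blast
    then have "level_diagonal M m \<subseteq> {d \<in> D. x d = 0}"
      unfolding level_diagonal_span using diagonal_unit_in_D subspace_D lin lin(2)[of 0 0 0]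
      by (intro complex_vector.span_minimal) (auto simp: complex_vector.subspace_def)
    then show False using diagonal_unit_in_level_diagonal[OF p(1) that] p(2) by blast
  qed
  then show ?thesis using that by blast
qed

text \<open>Conjugation by \<open>u\<close> is multiplicative on \<open>D\<close> because
  \<open>star u * u\<close> commutes with \<open>D\<close> and is absorbed by \<open>u\<close>.
  Composing it with \<open>x\<close> therefore gives a character, nonzero at
  \<open>star u * u\<close>.\<close>

lemma graph_character:
  assumes u: "u \<in> matrix_units M n" and xy: "(x, y) \<in> graph_of D u"
  shows "x \<in> characters D" "y \<in> characters D" "x (u * star u) = 1" "y (star u * u) = 1"
    and "d \<in> D \<Longrightarrow> y d = x (u * d * star u)"
proof -
  show x: "x \<in> characters D" and x1: "x (u * star u) = 1"
    using xy by (auto simp: graph_of_iff)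
  show y: "y d = x (u * d * star u)" if "d \<in> D" for d
    using xy that by (auto simp: graph_of_iff)
  have pi: "u * (star u * u) = u" using matrix_unit_partial_isometry[OF u] by (simp add: mult.assoc)
  have "u * (star u * u) * star u = u * star u" using pi by simp
  then show y1: "y (star u * u) = 1"
    using y projections_in_D[OF u] x1 by simp
  note conj = conjugate_diagonal[OF u]
  have "y (a * b) = y a * y b" if ab: "a \<in> D" "b \<in> D" for a b
  proof -
    have "(u * a * star u) * (u * b * star u) = u * (a * (star u * u)) * b * star u"
      by (simp add: mult.assoc)
    also have "a * (star u * u) = star u * u * a"
      using diagonal_commute[OF ab(1) projections_in_D(2)[OF u]] .
    also have "u * (star u * u * a) * b * star u = u * (star u * u) * (a * b) * star u"
      by (simp add: mult.assoc)
    finally have "(u * a * star u) * (u * b * star u) = u * (a * b) * star u"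
      by (simp only: pi)
    then show ?thesis
      using y ab mult_D[OF ab] character_mult[OF x conj[OF ab(1)] conj[OF ab(2)]] by simp
  qed
  moreover have "y (a + b) = y a + y b" if "a \<in> D" "b \<in> D" for a b
    using that y complex_vector.subspace_add[OF subspace_D that]
      character_add[OF x conj[OF that(1)] conj[OF that(2)]]
    by (simp add: distrib_left distrib_right)
  moreover have "y (c *\<^sub>C a) = c * y a" if "a \<in> D" for a c
    using that y complex_vector.subspace_scale[OF subspace_D that]
      character_scaleC[OF x conj[OF that]]
    by (simp add: scaleC_mult_left scaleC_mult_right)
  moreover have "y \<in> extensional D" using xy by (simp add: graph_of_iff)
  moreover have "\<exists>a\<in>D. y a \<noteq> 0"
    using y1 projections_in_D[OF u] by (intro bexI[of _ "star u * u"]) auto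
  ultimately show "y \<in> characters D"
    unfolding characters_def by blast
qed

text \<open>Evaluating \<open>x\<close> at \<open>p * u * q * star u\<close> gives
  \<open>x p\<close> times \<open>y q\<close>, that is 1, and characters are contractive.\<close>

lemma norm_corner_ge_1:
  assumes u: "u \<in> matrix_units M n" and xy: "(x, y) \<in> graph_of D u"
    and p: "p \<in> D" "x p = 1" and q: "q \<in> D" "y q = 1"
  shows "1 \<le> norm (p * u * q)"
proof -
  note c = conjugate_diagonal[OF u q(1)]
  have "x (p * (u * q * star u)) = 1"
    using character_mult[OF graph_character(1)[OF u xy] p(1) c] p graph_character(5)[OF u xy q(1)] q
    by simp
  then have "1 \<le> norm (p * (u * q * star u))"
    using character_le[OF graph_character(1)[OF u xy] mult_D[OF p(1) c]] by simp
  also have "\<dots> = norm ((p * u * q) * star u)" by (simp add: mult.assoc)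
  also have "\<dots> \<le> norm (p * u * q)"
    using norm_mult_ineq[of "p * u * q" "star u"] norm_matrix_unit[OF u] by simp
  finally show ?thesis .
qed

lemma graph_subset_essential_support:
  assumes "u \<in> matrix_units M n"
  shows "graph_of D u \<subseteq> essential_support D u"
proof (rule subrelI)
  fix x y assume xy: "(x, y) \<in> graph_of D u"
  show "(x, y) \<in> essential_support D u"
    using graph_character(1,2)[OF assms xy] norm_corner_ge_1[OF assms xy]
    by (auto simp: essential_support_def corner_bound_def intro!: exI[of _ 1])
qed

text \<open>Decompose \<open>u\<close> into matrix units \<open>f\<close> of a deep level. The corner of \<open>a\<close> at \<open>f\<close>
  is nearly a multiple of \<open>f\<close> bounded away from \<open>0\<close>, so rescaling and adding
  the corners gives elements of \<open>A\<close> that converge to \<open>u\<close>: the errors are orthogonal and do not add up.\<close>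

lemma matrix_unit_in_algebra:
  assumes a: "a \<in> A" and u: "u \<in> matrix_units M n"
    and near: "norm (u * star u * a * (star u * u) - u) < 1"
  shows "u \<in> A"
proof -
  define s where "s = u * star u * a * (star u * u)"
  define \<gamma> where "\<gamma> = norm (s - u)"
  have \<gamma>: "0 \<le> \<gamma>" "\<gamma> < 1" using near by (simp_all add: \<gamma>_def s_def)
  \<comment> \<open>With this choice \<kappa> + \<gamma> = 1 - \<kappa>, so a scalar within \<kappa>
    + \<gamma> of 1 has modulus at least \<kappa>.\<close>
  define \<kappa> where "\<kappa> = (1 - \<gamma>) / 2"
  have \<kappa>: "0 < \<kappa>" using \<gamma> by (simp add: \<kappa>_def)
  have s: "s \<in> A"
    unfolding s_def using a projections_in_D[OF u] by (intro corner_A)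
  have "\<exists>g\<in>A. dist g u < e" if e: "0 < e" for e
  proof -
    \<comment> \<open>The first bound keeps the scalars \<beta> away from 0; the second makes the
      error \<eta> / \<kappa>, left after dividing by them, smaller than \<open>e\<close>.\<close>
    define \<eta> where "\<eta> = min \<kappa> (e * \<kappa> / 2)"
    have \<eta>: "0 < \<eta>" "\<eta> \<le> \<kappa>" "\<eta> / \<kappa> < e"
      using \<kappa> e by (auto simp: \<eta>_def divide_less_eq min_less_iff_disj)
    obtain m b where m: "n \<le> m" and b: "b \<in> level_algebra M m" and sb: "norm (s - b) < \<eta>"
      using level_approximation[OF \<eta>(1), where n=n and a=s] by blast
    obtain F where F: "F \<subseteq> matrix_units M m" and uF: "u = \<Sum>F"
      using matrix_unit_decomposition[OF u m] by blast
    have finF: "finite F" using F finite_matrix_units finite_subset by blast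
    have normF: "norm (\<Sum>F) \<le> 1" using uF norm_matrix_unit[OF u] by simp
    have corner_le: "norm (f * star f * c * (star f * f)) \<le> norm c"
      if "f \<in> F" for f c
    proof -
      have f: "f \<in> matrix_units M m" using that F by blast
      have "norm (f * star f) \<le> 1" "norm (star f * f) \<le> 1"
        using norm_matrix_unit[OF f] by (simp_all add: norm_mult_star cstar_identity)
      then show ?thesis by (intro norm_corner_le order_refl)
    qed
    have "\<exists>\<beta>. f * star f * b * (star f * f) = \<beta> *\<^sub>C f \<and> \<kappa> \<le> cmod \<beta>" if fF: "f \<in> F" for f
    proof -
      have f: "f \<in> matrix_units M m" using fF F by blast
      have fu: "f * star f * u * (star f * f) = f"
        using contractive_sum_matrix_units_corner[OF F normF fF] uF
          matrix_unit_partial_isometry[OF f] by (simp add: mult.assoc[symmetric])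
      have "norm (b - u) \<le> \<eta> + \<gamma>"
        using norm_triangle_ineq[of "b - s" "s - u"] sb by (simp add: \<gamma>_def norm_minus_commute)
      then have near_f: "norm (f * star f * b * (star f * f) - f) \<le> \<eta> + \<gamma>"
        using corner_le[OF fF, of "b - u"] by (simp add: left_diff_distrib right_diff_distrib fu)
      have "\<exists>\<beta>. f * star f * b * (star f * f) = \<beta> *\<^sub>C f"
      proof (cases "f * star f * b * (star f * f) = 0")
        case True
        then show ?thesis by (intro exI[of _ 0]) simp
      next
        case False
        then obtain v \<beta> where "v \<in> matrix_units M m" "v * star v = f * star f"
          "star v * v = star f * f" "f * star f * b * (star f * f) = \<beta> *\<^sub>C v"
          using matrix_algebra_corner[OF range_projection_diagonal[OF f]
              source_projection_diagonal[OF f] b] by blast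
        then show ?thesis using matrix_unit_eqI[OF _ f] by blast
      qed
      then obtain \<beta> where \<beta>: "f * star f * b * (star f * f) = \<beta> *\<^sub>C f" by blast
      have "norm (\<beta> *\<^sub>C f - f) = cmod (\<beta> - 1)"
        using norm_scaleC[of "\<beta> - 1" f] norm_matrix_unit[OF f] scaleC_one[of f]
          complex_vector.scale_left_diff_distrib[of \<beta> 1 f] by simp
      then have "cmod (\<beta> - 1) \<le> \<eta> + \<gamma>" using near_f \<beta> by simp
      then have "\<kappa> \<le> cmod \<beta>"
        using norm_triangle_ineq2[of 1 "1 - \<beta>"] \<eta>(2) \<gamma>
        by (simp add: \<kappa>_def norm_minus_commute field_simps)
      then show ?thesis using \<beta> by blast
    qed
    then obtain \<beta> where \<beta>: "\<And>f. f \<in> F \<Longrightarrow> f * star f * b * (star f * f) = \<beta> f *\<^sub>C f"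
      and \<beta>\<kappa>: "\<And>f. f \<in> F \<Longrightarrow> \<kappa> \<le> cmod (\<beta> f)" by metis
    \<comment> \<open>With \<open>b\<close> in place of \<open>s\<close> this sum would be exactly
      \<open>u\<close>; with \<open>s\<close> it stays in \<open>A\<close>.\<close>
    define g where "g = (\<Sum>f\<in>F. (1 / \<beta> f) *\<^sub>C (f * star f * s * (star f * f)))"
    have "f * star f * s * (star f * f) \<in> A" if "f \<in> F" for f
      using projections_in_D[of f m] F that by (intro corner_A s) auto
    then have "g \<in> A"
      unfolding g_def
      by (intro complex_vector.subspace_sum complex_vector.subspace_scale
          subalgebra_subspace[OF subalgebra_A])
    define y where "y f = (1 / \<beta> f) *\<^sub>C (f * star f * (s - b) * (star f * f))" for f
    have "g - u = (\<Sum>f\<in>F. (1 / \<beta> f) *\<^sub>C (f * star f * s * (star f * f)) - f)"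
      by (simp add: g_def uF sum_subtractf)
    also have "\<dots> = sum y F"
    proof (rule sum.cong)
      fix f assume f: "f \<in> F"
      have "\<beta> f \<noteq> 0" using \<beta>\<kappa>[OF f] \<kappa> by auto
      then have "f = (1 / \<beta> f) *\<^sub>C (f * star f * b * (star f * f))"
        using \<beta>[OF f] by (simp add: scaleC_scaleC scaleC_one)
      then show "(1 / \<beta> f) *\<^sub>C (f * star f * s * (star f * f)) - f = y f"
        unfolding y_def
        by (simp add: left_diff_distrib right_diff_distrib
            complex_vector.scale_right_diff_distrib)
    qed simp
    finally have gu: "g - u = sum y F" .
    have "norm (sum y F) \<le> \<eta> / \<kappa>"
    proof (rule norm_orthogonal_sum_le[OF finF])
      fix f assume f: "f \<in> F"
      have "norm (f * star f * (s - b) * (star f * f)) \<le> \<eta>"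
        using corner_le[OF f, of "s - b"] sb by linarith
      then have "norm (f * star f * (s - b) * (star f * f)) / cmod (\<beta> f) \<le> \<eta> / \<kappa>"
        using \<beta>\<kappa>[OF f] \<kappa> \<eta> by (intro frac_le) auto
      then show "norm (y f) \<le> \<eta> / \<kappa>"
        by (simp add: y_def norm_scaleC norm_divide)
      fix h assume h: "h \<in> F" and fh: "f \<noteq> h"
      have "f * star h = 0" "star f * h = 0"
        using contractive_sum_matrix_units_orthogonal[OF F normF f h fh] by auto
      then have "star f * f * (star h * h) = 0" "f * star f * (h * star h) = 0"
        by (metis mult.assoc mult_zero_left mult_zero_right)+
      then have "\<And>z. star f * f * (star h * h * z) = 0" "\<And>z. f * star f * (h * star h * z) = 0"
        by (metis mult.assoc mult_zero_left)+
      then show "star (y f) * y h = 0" "y f * star (y h) = 0"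
        by (simp_all add: y_def star_scaleC star_mult scaleC_mult_left scaleC_mult_right mult.assoc)
    qed (use \<eta> \<kappa> in simp)
    then have "dist g u < e" using gu \<eta>(3) by (simp add: dist_norm)
    then show ?thesis using \<open>g \<in> A\<close> by blast
  qed
  then have "u \<in> closure A" by (simp add: closure_approachable)
  then show ?thesis using closed_A by simp
qed

text \<open>If \<open>y\<close> differed from the image of \<open>x\<close> under \<open>u\<close>, some diagonal matrix unit \<open>d\<close> would separate
  them and yield projections \<open>p\<close>, \<open>q\<close> with \<open>x p = y q = 1\<close> and \<open>p u q = 0\<close>.\<close>

lemma graph_of_if_corner_near:
  assumes x: "x \<in> characters D" and y: "y \<in> characters D"
    and bound: "corner_bound D a x y \<epsilon>"
    and u: "u \<in> matrix_units M n" and xu: "x (u * star u) = 1" and yu: "y (star u * u) = 1"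
    and near: "norm (u * star u * a * (star u * u) - \<beta> *\<^sub>C u) < \<epsilon>"
  shows "(x, y) \<in> graph_of D u"
proof -
  define p0 where "p0 = u * star u"
  define q0 where "q0 = star u * u"
  note pD = projections_in_D(1)[OF u, folded p0_def] and qD = projections_in_D(2)[OF u, folded q0_def]
  have p0: "p0 \<in> diagonal_units n" and q0: "q0 \<in> diagonal_units n"
    using range_projection_diagonal[OF u] source_projection_diagonal[OF u]
    by (simp_all add: p0_def q0_def)
  have p0u: "p0 * u = u" and uq0: "u * q0 = u" and q0u: "q0 * star u = star u"
    using matrix_unit_partial_isometry[OF u] matrix_unit_partial_isometry[OF star_matrix_unit[OF u]]
    by (simp_all add: p0_def q0_def mult.assoc)
  have separate: False
    if p: "p \<in> D" "star p = p" "p * p = p" "x p = 1" and q: "q \<in> D" "star q = q" "q * q = q" "y q = 1"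
      and pp0: "p * p0 = p" and q0q: "q0 * q = q" and puq: "p * u * q = 0" for p q
  proof -
    have "norm p \<le> 1" "norm q \<le> 1" using p q by (simp_all add: norm_projection_le_1)
    then have "\<epsilon> \<le> norm (p * a * q)" using bound p q by (simp add: corner_bound_def)
    also have "p * a * q = p * (p0 * a * q0 - \<beta> *\<^sub>C u) * q"
    proof -
      have "p * (p0 * a * q0) * q = (p * p0) * a * (q0 * q)" by (simp add: mult.assoc)
      then show ?thesis
        using puq pp0 q0q
        by (simp add: left_diff_distrib right_diff_distrib scaleC_mult_left scaleC_mult_right)
    qed
    also have "norm \<dots> \<le> norm (p0 * a * q0 - \<beta> *\<^sub>C u)"
      using \<open>norm p \<le> 1\<close> \<open>norm q \<le> 1\<close> by (intro norm_corner_le order_refl)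
    finally show False using near by (simp add: p0_def q0_def)
  qed
  have agree: "y d = x (u * d * star u)" if d: "d \<in> diagonal_units m" for d m
  proof (rule ccontr)
    assume neq: "y d \<noteq> x (u * d * star u)"
    note dD = diagonal_unit_in_D[OF d]
    have dd: "star d = d" "d * d = d"
      using star_diagonal_unit[OF d] diagonal_unit_idem[OF d] by simp_all
    define c where "c = u * d * star u"
    have cD: "c \<in> D" unfolding c_def by (rule conjugate_diagonal[OF u dD])
    have dq: "d * q0 = q0 * d" by (rule diagonal_commute[OF dD qD])
    \<comment> \<open>\<open>c\<close> is \<open>d\<close> carried to the range side of
      \<open>u\<close>. By this identity both pairs, \<open>p0 - c\<close> with
      \<open>q0 * d\<close> and \<open>c\<close> with \<open>q0 - q0 * d\<close>, give
      \<open>p * u * q = 0\<close>; which pair separates depends on whether \<open>y d\<close> is 1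
      or 0.\<close>
    have cu: "c * u = u * d"
    proof -
      have "c * u = u * (d * q0)" by (simp add: c_def q0_def mult.assoc)
      also have "\<dots> = (u * q0) * d" by (simp add: dq mult.assoc)
      finally show ?thesis by (simp add: uq0)
    qed
    have cc: "c * c = c"
    proof -
      have "c * c = (c * u) * d * star u" by (simp add: c_def mult.assoc)
      also have "\<dots> = u * (d * d) * star u" by (simp add: cu mult.assoc)
      finally show ?thesis by (simp add: dd c_def)
    qed
    have sc: "star c = c" by (simp add: c_def star_mult dd mult.assoc)
    have p0c: "p0 * c = c" using p0u by (simp add: c_def mult.assoc[symmetric])
    have cp0: "c * p0 = c" using diagonal_commute[OF cD pD] p0c by simp
    have pp: "p0 * p0 = p0" "star p0 = p0" "q0 * q0 = q0" "star q0 = q0"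
      using p0 q0 by (simp_all add: diagonal_unit_idem star_diagonal_unit)
    have xp0: "x p0 = 1" and yq0: "y q0 = 1" using xu yu by (simp_all add: p0_def q0_def)
    consider "y d = 1" "x c = 0" | "y d = 0" "x c = 1"
      using neq character_idempotent[OF x cD cc] character_idempotent[OF y dD dd(2)]
      by (auto simp: c_def)
    then show False
    proof cases
      case 1
      show False
      proof (rule separate[of "p0 - c" "q0 * d"])
        show "x (p0 - c) = 1"
          using character_diff[OF subalgebra_diagonal x pD cD] xp0 1 by simp
        show "y (q0 * d) = 1" using character_mult[OF y qD dD] yq0 1 by simp
        show "(p0 - c) * (p0 - c) = p0 - c"
          by (simp add: left_diff_distrib right_diff_distrib pp cc p0c cp0)
        show "q0 * d * (q0 * d) = q0 * d"
          using dq pp dd by (metis mult.assoc)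
        show "(p0 - c) * u * (q0 * d) = 0"
        proof -
          have "(p0 - c) * u * (q0 * d) = (u - u * d) * q0 * d"
            by (simp add: left_diff_distrib p0u cu mult.assoc)
          also have "\<dots> = (u - u * d) * (d * q0)" by (simp add: dq mult.assoc)
          also have "\<dots> = (u * d - u * (d * d)) * q0"
            by (simp add: left_diff_distrib mult.assoc)
          finally show ?thesis by (simp add: dd)
        qed
      qed (use pD cD qD dD diff_D mult_D in
          \<open>simp_all add: star.diff star_mult pp dd sc dq left_diff_distrib cp0 mult.assoc[symmetric]\<close>)
    next
      case 2
      show False
      proof (rule separate[of c "q0 - q0 * d"])
        have qdD: "q0 * d \<in> D" by (rule mult_D[OF qD dD])
        show "q0 - q0 * d \<in> D" using diff_D[OF qD qdD] .
        show "y (q0 - q0 * d) = 1"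
          using character_diff[OF subalgebra_diagonal y qD qdD] character_mult[OF y qD dD] yq0 2
          by simp
        show "star (q0 - q0 * d) = q0 - q0 * d" by (simp add: star.diff star_mult pp dd dq)
        have idem: "q0 * d * (q0 * d) = q0 * d" "q0 * d * q0 = q0 * d" "q0 * (q0 * d) = q0 * d"
          using dq pp dd by (metis mult.assoc)+
        show "(q0 - q0 * d) * (q0 - q0 * d) = q0 - q0 * d"
          by (simp add: left_diff_distrib right_diff_distrib idem pp)
        show "q0 * (q0 - q0 * d) = q0 - q0 * d"
          by (simp add: right_diff_distrib idem pp)
        have "c * u * (q0 - q0 * d) = u * (d * q0) - u * (d * (q0 * d))"
          by (simp add: cu right_diff_distrib mult.assoc)
        also have "d * (q0 * d) = d * q0" using dq dd by (metis mult.assoc)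
        finally show "c * u * (q0 - q0 * d) = 0" by simp
      qed (use cD sc cc 2 cp0 in simp_all)
    qed
  qed
  have "y d = x (u * d * star u)" if d: "d \<in> D" for d
  proof -
    note conj = conjugate_diagonal[OF u]
    have "y d - x (u * d * star u) = 0"
    proof (rule linear_functional_diagonal_eq_0[where K=2 and n=0 and
          \<phi>="\<lambda>d. y d - x (u * d * star u)"])
      show "y (a + b) - x (u * (a + b) * star u) =
          y a - x (u * a * star u) + (y b - x (u * b * star u))" if "a \<in> D" "b \<in> D" for a b
        using that character_add[OF y that] character_add[OF x conj[OF that(1)] conj[OF that(2)]]
        by (simp add: distrib_left distrib_right)
      show "y (c *\<^sub>C a) - x (u * (c *\<^sub>C a) * star u) = c * (y a - x (u * a * star u))"
        if "a \<in> D" for c a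
        using that character_scaleC[OF y that] character_scaleC[OF x conj[OF that]]
        by (simp add: scaleC_mult_left scaleC_mult_right right_diff_distrib)
      show "cmod (y a - x (u * a * star u)) \<le> 2 * norm a" if "a \<in> D" for a
      proof -
        have "norm (u * a * star u) \<le> norm a"
          using norm_matrix_unit[OF u] by (intro norm_corner_le) auto
        then show ?thesis
          using norm_triangle_ineq4[of "y a" "x (u * a * star u)"]
            character_le[OF y that] character_le[OF x conj[OF that]] by linarith
      qed
    qed (use agree d in auto)
    then show ?thesis by simp
  qed
  moreover have "y \<in> extensional D" using y by (rule character_extensional)
  ultimately have "y = (\<lambda>d\<in>D. x (u * d * star u))"
    by (auto simp: fun_eq_iff extensional_def)
  then show ?thesis using x xu by (simp add: graph_of_iff)
qed

text \<open>Pass to a level where \<open>x\<close> and \<open>y\<close> are 1 on diagonal units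
  \<open>p\<close> and \<open>q\<close>. The corner \<open>p * a * q\<close> has norm at least
  \<epsilon>, so \<open>p * b * q\<close> cannot vanish and is a multiple of one matrix unit
  \<open>u\<close>. This multiple is close enough to the corner of \<open>a\<close> to force
  \<open>y\<close> to be the image of \<open>x\<close> under \<open>u\<close>.\<close>

lemma essential_support_approximant:
  assumes x: "x \<in> characters D" and y: "y \<in> characters D"
    and bound: "corner_bound D a x y \<epsilon>"
    and b: "b \<in> level_algebra M n" and ab: "norm (a - b) < \<epsilon>"
  obtains m u \<beta> where "n \<le> m" "u \<in> matrix_units M m" "(x, y) \<in> graph_of D u"
    "u * star u * b * (star u * u) = \<beta> *\<^sub>C u" "\<epsilon> - norm (a - b) \<le> cmod \<beta>"
proof -
  obtain n1 where n1: "\<forall>m\<ge>n1. \<exists>p\<in>diagonal_units m. x p = 1"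
    by (rule character_diagonal_unit[OF x])
  obtain n2 where n2: "\<forall>m\<ge>n2. \<exists>p\<in>diagonal_units m. y p = 1"
    by (rule character_diagonal_unit[OF y])
  define m where "m = max n (max n1 n2)"
  have "n1 \<le> m" "n2 \<le> m" by (simp_all add: m_def)
  then obtain p q where p: "p \<in> diagonal_units m" "x p = 1" and q: "q \<in> diagonal_units m" "y q = 1"
    using n1 n2 by blast
  have bm: "b \<in> level_algebra M m" using level_algebra_mono[of n m] b by (auto simp: m_def)
  have pq1: "norm p \<le> 1" "norm q \<le> 1"
    using norm_matrix_unit diagonal_unit_matrix_unit p q by force+
  have "\<epsilon> \<le> norm (p * a * q)"
    using bound diagonal_unit_in_D p q pq1 by (simp add: corner_bound_def)
  also have "p * a * q = p * (a - b) * q + p * b * q"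
    by (simp add: left_diff_distrib right_diff_distrib)
  also have "norm \<dots> \<le> norm (p * (a - b) * q) + norm (p * b * q)" by (rule norm_triangle_ineq)
  also have "norm (p * (a - b) * q) \<le> norm (a - b)"
    using pq1 by (intro norm_corner_le order_refl)
  finally have large: "\<epsilon> - norm (a - b) \<le> norm (p * b * q)" by simp
  then have "p * b * q \<noteq> 0" using ab by auto
  then obtain u \<beta> where u: "u \<in> matrix_units M m" "u * star u = p" "star u * u = q"
      and \<beta>: "p * b * q = \<beta> *\<^sub>C u"
    using matrix_algebra_corner[OF p(1) q(1) bm] by blast
  have "norm (p * a * q - \<beta> *\<^sub>C u) \<le> norm (a - b)"
  proof -
    have "p * a * q - \<beta> *\<^sub>C u = p * (a - b) * q"
      by (simp add: \<beta>[symmetric] left_diff_distrib right_diff_distrib)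
    then show ?thesis using pq1 by (auto intro: norm_corner_le)
  qed
  then have "(x, y) \<in> graph_of D u"
    using p q u ab by (intro graph_of_if_corner_near[OF x y bound u(1), where \<beta>=\<beta>]) auto
  moreover have "\<epsilon> - norm (a - b) \<le> cmod \<beta>"
    using large \<beta> norm_matrix_unit[OF u(1)] by (simp add: norm_scaleC)
  moreover have "u * star u * b * (star u * u) = \<beta> *\<^sub>C u" using u \<beta> by simp
  moreover have "n \<le> m" by (simp add: m_def)
  ultimately show ?thesis using u(1) that by meson
qed

lemma essential_supportE:
  assumes "(x, y) \<in> essential_support D a"
  obtains \<epsilon> where "x \<in> characters D" "y \<in> characters D" "0 < \<epsilon>" "corner_bound D a x y \<epsilon>"
proof -
  from assms have "x \<in> characters D \<and> y \<in> characters D \<and> (\<exists>\<epsilon>>0. corner_bound D a x y \<epsilon>)"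
    by (simp add: essential_support_def)
  then obtain \<epsilon> where "x \<in> characters D" "y \<in> characters D" "0 < \<epsilon>" "corner_bound D a x y \<epsilon>"
    by (elim conjE exE)
  then show ?thesis by (rule that)
qed

text \<open>The source of openness of essential supports. The matrix unit joining \<open>x\<close>
  to \<open>y\<close> at a deep level carries a coefficient bounded below, and this one coefficient
  controls the corners of \<open>a\<close> at every point of its graph.\<close>

lemma essential_support_covered:
  assumes a: "a \<in> A" and xy: "(x, y) \<in> essential_support D a"
  obtains u where "u \<in> matrix_units_in M A" "(x, y) \<in> graph_of D u"
    "graph_of D u \<subseteq> essential_support D a"
proof -
  obtain \<epsilon> where x: "x \<in> characters D" and y: "y \<in> characters D" and \<epsilon>: "0 < \<epsilon>"
    and bound: "corner_bound D a x y \<epsilon>"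
    by (rule essential_supportE[OF xy])
  \<comment> \<open>With error below \<epsilon> / 4 the coefficient \<beta> has modulus above 3
    \<epsilon> / 4. The quotient of error and modulus is below 1, which puts \<open>u\<close> in
    \<open>A\<close>; their difference is above \<epsilon> / 2, the bound used along the whole
    graph.\<close>
  have "0 < \<epsilon> / 4" using \<epsilon> by simp
  then obtain n b where b: "b \<in> level_algebra M n" and ab: "norm (a - b) < \<epsilon> / 4"
    using level_approximation[where n=0 and a=a] by blast
  have "norm (a - b) < \<epsilon>" using ab \<epsilon> by simp
  then obtain m u \<beta> where "n \<le> m" and u: "u \<in> matrix_units M m" and g: "(x, y) \<in> graph_of D u"
    and \<beta>: "u * star u * b * (star u * u) = \<beta> *\<^sub>C u" and "\<epsilon> - norm (a - b) \<le> cmod \<beta>"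
    by (rule essential_support_approximant[OF x y bound b])
  then have \<beta>large: "3 / 4 * \<epsilon> < cmod \<beta>" using ab by simp
  have uu: "norm (u * star u) \<le> 1" "norm (star u * u) \<le> 1"
    using norm_matrix_unit[OF u] by (simp_all add: norm_mult_star cstar_identity)
  have near: "norm (u * star u * a * (star u * u) - \<beta> *\<^sub>C u) \<le> \<epsilon> / 4"
  proof -
    have "u * star u * a * (star u * u) - \<beta> *\<^sub>C u = u * star u * (a - b) * (star u * u)"
      by (simp add: \<beta>[symmetric] left_diff_distrib right_diff_distrib)
    moreover have "norm (u * star u * (a - b) * (star u * u)) \<le> \<epsilon> / 4"
      using uu ab by (intro norm_corner_le) auto
    ultimately show ?thesis by simp
  qed
  have "u \<in> A"
  proof (rule matrix_unit_in_algebra[OF _ u])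
    have nz: "\<beta> \<noteq> 0" using \<beta>large \<epsilon> by auto
    show "(1 / \<beta>) *\<^sub>C a \<in> A"
      using a subalgebra_subspace[OF subalgebra_A] by (rule complex_vector.subspace_scale[rotated])
    have "u * star u * ((1 / \<beta>) *\<^sub>C a) * (star u * u) - u =
        (1 / \<beta>) *\<^sub>C (u * star u * a * (star u * u) - \<beta> *\<^sub>C u)"
      using nz by (simp add: scaleC_mult_left scaleC_mult_right scaleC_scaleC scaleC_one
          complex_vector.scale_right_diff_distrib)
    also have "norm \<dots> = norm (u * star u * a * (star u * u) - \<beta> *\<^sub>C u) / cmod \<beta>"
      by (simp add: norm_scaleC norm_divide)
    also have "\<dots> \<le> (\<epsilon> / 4) / cmod \<beta>"
      by (rule divide_right_mono[OF near norm_ge_zero])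
    also have "\<dots> < 1" using \<beta>large \<epsilon> nz by (simp add: divide_less_eq)
    finally show "norm (u * star u * ((1 / \<beta>) *\<^sub>C a) * (star u * u) - u) < 1" .
  qed
  then have "u \<in> matrix_units_in M A" using u by (auto simp: matrix_units_in_def)
  moreover have "graph_of D u \<subseteq> essential_support D a"
  proof
    fix g assume "g \<in> graph_of D u"
    moreover obtain z w where gzw: "g = (z, w)" by (cases g)
    ultimately have zw: "(z, w) \<in> graph_of D u" by simp
    have "\<epsilon> / 2 \<le> norm (p * a * q)"
      if p: "p \<in> D" "norm p \<le> 1" "z p = 1" and q: "q \<in> D" "norm q \<le> 1" "w q = 1" for p q
    proof -
      \<comment> \<open>As \<open>p\<close> and \<open>q\<close> commute with the projections of
        \<open>u\<close>, the compression by these can be moved outside \<open>p * a * q\<close>,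
        where it does not increase the norm.\<close>
      have comm: "p * (u * star u) = u * star u * p" "q * (star u * u) = star u * u * q"
        using diagonal_commute p q projections_in_D[OF u] by auto
      have "cmod \<beta> * 1 \<le> cmod \<beta> * norm (p * u * q)"
        using norm_corner_ge_1[OF u zw p(1,3) q(1,3)] by (intro mult_left_mono) auto
      also have "\<dots> = norm (p * (\<beta> *\<^sub>C u) * q)"
        by (simp add: norm_scaleC scaleC_mult_left scaleC_mult_right)
      also have "p * (\<beta> *\<^sub>C u) * q = p * (u * star u * a * (star u * u)) * q -
          p * (u * star u * a * (star u * u) - \<beta> *\<^sub>C u) * q"
        by (simp add: left_diff_distrib right_diff_distrib)
      also have "norm \<dots> \<le> norm (p * (u * star u * a * (star u * u)) * q) +
          norm (p * (u * star u * a * (star u * u) - \<beta> *\<^sub>C u) * q)"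
        by (rule norm_triangle_ineq4)
      also have "norm (p * (u * star u * a * (star u * u) - \<beta> *\<^sub>C u) * q) \<le> \<epsilon> / 4"
        using p q near by (intro norm_corner_le) auto
      also have "p * (u * star u * a * (star u * u)) * q =
          (p * (u * star u)) * a * (star u * u * q)"
        by (simp add: mult.assoc)
      also have "\<dots> = u * star u * (p * a * q) * (star u * u)"
        unfolding comm(1) comm(2)[symmetric] by (simp add: mult.assoc)
      also have "norm \<dots> \<le> norm (p * a * q)"
        using uu by (intro norm_corner_le order_refl)
      finally show ?thesis using \<beta>large by simp
    qed
    then show "g \<in> essential_support D a"
      using graph_character[OF u zw] \<epsilon> unfolding gzw
      by (auto simp: essential_support_def corner_bound_def intro!: exI[of _ "\<epsilon> / 2"])
  qed
  ultimately show ?thesis using that g by blast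
qed

lemma matrix_units_inE:
  assumes "u \<in> matrix_units_in M B" obtains n where "u \<in> matrix_units M n" "u \<in> B"
  using assms by (auto simp: matrix_units_in_def)

text \<open>Here \<open>e\<close> is its own approximant, with error 0. The matrix unit
  \<open>u\<close> found at a deeper level must be a summand of \<open>e\<close>, for otherwise its
  corner of \<open>e\<close> would vanish. Since \<open>u\<close> is \<open>e\<close> cut down by
  \<open>u * star u\<close>, where \<open>x\<close> is 1, both carry \<open>x\<close> to the same
  character.\<close>

lemma essential_support_matrix_unit:
  assumes "e \<in> matrix_units_in M A"
  shows "essential_support D e = graph_of D e"
proof
  obtain n where e: "e \<in> matrix_units M n" and eA: "e \<in> A"
    using assms by (rule matrix_units_inE)
  show "graph_of D e \<subseteq> essential_support D e"
    by (rule graph_subset_essential_support[OF e])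
  show "essential_support D e \<subseteq> graph_of D e"
  proof
    fix g assume "g \<in> essential_support D e"
    moreover obtain x y where g: "g = (x, y)" by (cases g)
    ultimately have xy: "(x, y) \<in> essential_support D e" by simp
    obtain \<epsilon> where x: "x \<in> characters D" and y: "y \<in> characters D" and \<epsilon>: "0 < \<epsilon>"
      and bound: "corner_bound D e x y \<epsilon>"
      by (rule essential_supportE[OF xy])
    have eL: "e \<in> level_algebra M n"
      using e by (simp add: level_algebra_def complex_vector.span_base)
    have "norm (e - e) < \<epsilon>" using \<epsilon> by simp
    then obtain m u \<beta> where m: "n \<le> m" and u: "u \<in> matrix_units M m"
      and xyu: "(x, y) \<in> graph_of D u"
      and \<beta>: "u * star u * e * (star u * u) = \<beta> *\<^sub>C u" "\<epsilon> - norm (e - e) \<le> cmod \<beta>"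
      by (rule essential_support_approximant[OF x y bound eL])
    obtain F where F: "F \<subseteq> matrix_units M m" and eF: "e = \<Sum>F"
      using matrix_unit_decomposition[OF e m] by blast
    have normF: "norm (\<Sum>F) \<le> 1" using norm_matrix_unit[OF e] eF by simp
    have finF: "finite F" using F finite_matrix_units finite_subset by blast
    have "u \<in> F"
    proof (rule ccontr)
      assume "u \<notin> F"
      have "u * star u * f * (star u * u) = 0" if f: "f \<in> F" for f
      proof (rule ccontr)
        assume nz: "u * star u * f * (star u * u) \<noteq> 0"
        have fm: "f \<in> matrix_units M m" using f F by blast
        have "u * star u = f * star f"
          using nz diagonal_unit_mult_matrix_unit[OF range_projection_diagonal[OF u] fm]
          by (auto split: if_splits)
        moreover have "star u * u = star f * f"
          using nz matrix_unit_mult_diagonal_unit[OF source_projection_diagonal[OF u] fm]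
          by (auto simp: mult.assoc split: if_splits)
        ultimately show False using matrix_unit_eqI[OF u fm] f \<open>u \<notin> F\<close> by blast
      qed
      then have "u * star u * e * (star u * u) = 0"
        by (simp add: eF sum_distrib_left sum_distrib_right)
      then show False using \<beta> \<epsilon> matrix_unit_nonzero[OF u]
        by (auto dest!: arg_cong[of _ _ norm] simp: norm_scaleC)
    qed
    have ue: "u * star u * e = u"
      using contractive_sum_matrix_units_corner[OF F normF \<open>u \<in> F\<close>] eF by simp
    have eu: "star e * (u * star u) = star u"
      using arg_cong[OF ue, of star] by (simp add: star_mult mult.assoc)
    note pu = projections_in_D(1)[OF u] and pe = projections_in_D(1)[OF e]
    note xu = graph_character(3)[OF u xyu]
    have "u * star u * (e * star e) * (u * star u) = u * star u"
      using ue eu by (metis mult.assoc)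
    then have xe: "x (e * star e) = 1"
      using character_mult[OF x mult_D[OF pu pe] pu] character_mult[OF x pu pe] xu by simp
    have "y d = x (e * d * star e)" if d: "d \<in> D" for d
    proof -
      note c = conjugate_diagonal[OF e d]
      have "u * star u * (e * d * star e) * (u * star u) = u * d * star u"
        using ue eu by (metis mult.assoc)
      then have "x (e * d * star e) = x (u * d * star u)"
        using character_mult[OF x mult_D[OF pu c] pu] character_mult[OF x pu c] xu by simp
      then show ?thesis using graph_character(5)[OF u xyu d] by simp
    qed
    then have "y = (\<lambda>d\<in>D. x (e * d * star e))"
      using character_extensional[OF y] by (auto simp: fun_eq_iff extensional_def)
    then show "g \<in> graph_of D e" using x xe by (simp add: g graph_of_iff)
  qed
qed

section \<open>The fundamental relation, its edges and its topology\<close>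

lemma fundamental_relation_eq: "fundamental_relation M A = (\<Union>a\<in>A. essential_support D a)"
proof
  show "fundamental_relation M A \<subseteq> (\<Union>a\<in>A. essential_support D a)"
    unfolding fundamental_relation_def
  proof (rule UN_least)
    fix e assume e: "e \<in> matrix_units_in M A"
    then have "e \<in> A" by (auto elim: matrix_units_inE)
    then show "graph_of D e \<subseteq> (\<Union>a\<in>A. essential_support D a)"
      unfolding essential_support_matrix_unit[OF e, symmetric] by blast
  qed
  show "(\<Union>a\<in>A. essential_support D a) \<subseteq> fundamental_relation M A"
  proof (rule UN_least, rule subrelI)
    fix a x y assume "a \<in> A" "(x, y) \<in> essential_support D a"
    then obtain u where "u \<in> matrix_units_in M A" "(x, y) \<in> graph_of D u"
      by (rule essential_support_covered)
    then show "(x, y) \<in> fundamental_relation M A"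
      unfolding fundamental_relation_def by blast
  qed
qed

lemma fundamental_relation_characters:
  "(x, y) \<in> fundamental_relation M A \<Longrightarrow> x \<in> characters D \<and> y \<in> characters D"
  unfolding fundamental_relation_eq by (auto simp: essential_support_def)

text \<open>For matrix units of different levels \<open>e * g\<close> is in general not a matrix
  unit. Essential supports avoid decomposing it: \<open>g * q * star g\<close> takes the value 1 at
  \<open>y\<close> and can be used to test \<open>e\<close>.\<close>

lemma fundamental_relation_trans:
  assumes "(x, y) \<in> fundamental_relation M A" "(y, z) \<in> fundamental_relation M A"
  shows "(x, z) \<in> fundamental_relation M A"
proof -
  obtain e n where e: "e \<in> matrix_units M n" "e \<in> A" and xy: "(x, y) \<in> graph_of D e"
    using assms(1) by (auto simp: fundamental_relation_def elim: matrix_units_inE)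
  obtain g m where g: "g \<in> matrix_units M m" "g \<in> A" and yz: "(y, z) \<in> graph_of D g"
    using assms(2) by (auto simp: fundamental_relation_def elim: matrix_units_inE)
  have "1 \<le> norm (p * (e * g) * q)" if p: "p \<in> D" "x p = 1" and q: "q \<in> D" "z q = 1" for p q
  proof -
    have "y (g * q * star g) = 1" using graph_character(5)[OF g(1) yz q(1)] q by simp
    then have "1 \<le> norm (p * e * (g * q * star g))"
      using norm_corner_ge_1[OF e(1) xy p conjugate_diagonal[OF g(1) q(1)]] by simp
    also have "\<dots> = norm (p * (e * g) * q * star g)" by (simp add: mult.assoc)
    also have "\<dots> \<le> norm (p * (e * g) * q)"
      using norm_mult_ineq[of "p * (e * g) * q" "star g"] norm_matrix_unit[OF g(1)] by simp
    finally show ?thesis .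
  qed
  then have "(x, z) \<in> essential_support D (e * g)"
    using graph_character[OF e(1) xy] graph_character[OF g(1) yz]
    by (auto simp: essential_support_def corner_bound_def intro!: exI[of _ 1])
  then show ?thesis
    unfolding fundamental_relation_eq using mult_A[OF e(2) g(2)] by blast
qed

text \<open>For \<open>e\<close> in \<open>D\<close>, multiplicativity of \<open>x\<close> turns
  \<open>x (e * d * star e)\<close> into \<open>x d\<close>; conversely every character is 1 on some
  diagonal unit. So a cocycle vanishes exactly at the pairs with equal entries.\<close>

lemma graph_of_diagonal_matrix_units:
  "(\<Union>e\<in>matrix_units_in M D. graph_of D e) = {(x, x) | x. x \<in> characters D}"
proof (intro equalityI subsetI)
  fix g assume "g \<in> (\<Union>e\<in>matrix_units_in M D. graph_of D e)"
  moreover obtain x y where g: "g = (x, y)" by (cases g)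
  ultimately obtain e n where e: "e \<in> matrix_units M n" "e \<in> D" and xy: "(x, y) \<in> graph_of D e"
    by (auto elim: matrix_units_inE)
  note x = graph_character(1)[OF e(1) xy]
  have "x (e * d * star e) = x d" if d: "d \<in> D" for d
  proof -
    have "x (e * d * star e) = x e * x d * x (star e)"
      using character_mult[OF x mult_D[OF e(2) d] star_diagonal[OF e(2)]]
        character_mult[OF x e(2) d] by simp
    also have "\<dots> = x (e * star e) * x d"
      using character_mult[OF x e(2) star_diagonal[OF e(2)]] by simp
    finally show ?thesis using graph_character(3)[OF e(1) xy] by simp
  qed
  then have "y = x"
    using graph_character(5)[OF e(1) xy] character_extensional[OF x]
      character_extensional[OF graph_character(2)[OF e(1) xy]]
    by (intro extensionalityI[of _ D]) auto
  then show "g \<in> {(x, x) | x. x \<in> characters D}" using x g by blast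
next
  fix g assume "g \<in> {(x, x) | x. x \<in> characters D}"
  then obtain x where x: "x \<in> characters D" and g: "g = (x, x)" by blast
  obtain n where "\<forall>m\<ge>n. \<exists>p\<in>diagonal_units m. x p = 1"
    by (rule character_diagonal_unit[OF x])
  then obtain p where p: "p \<in> diagonal_units n" "x p = 1" by blast
  note pD = diagonal_unit_in_D[OF p(1)]
  have pp: "p * star p = p" "star p = p"
    using p by (simp_all add: star_diagonal_unit diagonal_unit_idem)
  have "x d = x (p * d * star p)" if d: "d \<in> D" for d
    using character_mult[OF x mult_D[OF pD d] pD] character_mult[OF x pD d] pp p by simp
  then have "x = (\<lambda>d\<in>D. x (p * d * star p))"
    using character_extensional[OF x] by (auto simp: fun_eq_iff extensional_def)
  then have "(x, x) \<in> graph_of D p" using x p pp by (simp add: graph_of_iff)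
  moreover have "p \<in> matrix_units_in M D"
    using pD diagonal_unit_matrix_unit[OF p(1)] by (auto simp: matrix_units_in_def)
  ultimately show "g \<in> (\<Union>e\<in>matrix_units_in M D. graph_of D e)" using g by blast
qed

lemma cocycle_eq_0_iff:
  assumes "cocycle M A \<delta>" "(x, y) \<in> fundamental_relation M A"
  shows "\<delta> (x, y) = 0 \<longleftrightarrow> x = y"
proof -
  have "{g \<in> fundamental_relation M A. \<delta> g = 0} = {(x, x) | x. x \<in> characters D}"
    using assms(1) unfolding cocycle_def graph_of_diagonal_matrix_units by blast
  then show ?thesis
    using assms(2) fundamental_relation_characters[OF assms(2)] by blast
qed

text \<open>Off-diagonal values are at least 1, so an element of value 1 cannot split. An element of
  value \<open>k\<close> at least 2 splits after the first step of a coherent path, the rest having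
  value \<open>k - 1\<close> by additivity.\<close>

lemma edges_indecomposable:
  assumes "continuous_coherent_cocycle M A \<delta>"
  shows "{g \<in> fundamental_relation M A. \<delta> g = 1} =
    indecomposable_pairs (fundamental_relation M A)"
    (is "?E = _")
  unfolding indecomposable_pairs_def
proof -
  let ?R = "fundamental_relation M A"
  let ?I = "{(x, z). (x, z) \<in> ?R \<and> x \<noteq> z \<and> \<not> (\<exists>y. (x, y) \<in> ?R \<and> (y, z) \<in> ?R \<and> x \<noteq> y \<and> y \<noteq> z)}"
  have coc: "cocycle M A \<delta>" and nat: "\<And>g. g \<in> ?R \<Longrightarrow> \<delta> g \<in> \<nat>" and coh: "coherent M A \<delta>"
    using assms by (auto simp: continuous_coherent_cocycle_def)
  have add: "\<delta> (x, z) = \<delta> (x, y) + \<delta> (y, z)" if "(x, y) \<in> ?R" "(y, z) \<in> ?R" for x y z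
    using coc that unfolding cocycle_def by blast
  note zero = cocycle_eq_0_iff[OF coc]
  have ge1: "1 \<le> \<delta> (x, y)" if R: "(x, y) \<in> ?R" and ne: "x \<noteq> y" for x y
  proof -
    obtain k :: nat where k: "\<delta> (x, y) = real k" using Nats_cases[OF nat[OF R]] by metis
    then have "k \<noteq> 0" using zero[OF R] ne by auto
    then show ?thesis using k by simp
  qed
  have iff: "(x, z) \<in> ?E \<longleftrightarrow> (x, z) \<in> ?I" for x z
  proof
    assume "(x, z) \<in> ?E"
    then have R: "(x, z) \<in> ?R" and d: "\<delta> (x, z) = 1" by auto
    have "False" if "(x, y) \<in> ?R" "(y, z) \<in> ?R" "x \<noteq> y" "y \<noteq> z" for y
      using add[OF that(1,2)] ge1[OF that(1,3)] ge1[OF that(2,4)] d by simp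
    moreover have "x \<noteq> z" using zero[OF R] d by auto
    ultimately show "(x, z) \<in> ?I" using R by blast
  next
    assume "(x, z) \<in> ?I"
    then have R: "(x, z) \<in> ?R" and xz: "x \<noteq> z"
      and indec: "\<And>y. (x, y) \<in> ?R \<Longrightarrow> (y, z) \<in> ?R \<Longrightarrow> x \<noteq> y \<Longrightarrow> y \<noteq> z \<Longrightarrow> False" by blast+
    obtain k :: nat where k: "\<delta> (x, z) = real k" using Nats_cases[OF nat[OF R]] by metis
    have "\<not> 2 \<le> k"
    proof
      assume k2: "2 \<le> k"
      then obtain p where p: "p 0 = x" "p k = z"
        and path: "\<And>i. i < k \<Longrightarrow> (p i, p (Suc i)) \<in> ?R \<and> \<delta> (p i, p (Suc i)) = 1"
        using coh R k unfolding coherent_def by metis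
      have reach: "(p 1, p j) \<in> ?R" if "2 \<le> j" "j \<le> k" for j
        using that
      proof (induction j rule: dec_induct)
        case base
        then show ?case using path[of 1] by (simp add: numeral_2_eq_2)
      next
        case (step j)
        then show ?case
          using fundamental_relation_trans[of "p 1" "p j"] path[of j] by simp
      qed
      have xp: "(x, p 1) \<in> ?R" "\<delta> (x, p 1) = 1" using path[of 0] p k2 by auto
      have pz: "(p 1, z) \<in> ?R" using reach[of k] k2 p by simp
      have "\<delta> (p 1, z) = real k - 1" using add[OF xp(1) pz] xp k by simp
      then have "p 1 \<noteq> z" "x \<noteq> p 1" using zero[OF pz] zero[OF xp(1)] xp(2) k2 by auto
      then show False using indec xp pz by blast
    qed
    moreover have "k \<noteq> 0" using zero[OF R] xz k by auto
    ultimately have "k = 1" by simp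
    then show "(x, z) \<in> ?E" using R k by simp
  qed
  show "?E = ?I"
  proof (rule set_eqI)
    fix g show "g \<in> ?E \<longleftrightarrow> g \<in> ?I" using iff[of "fst g" "snd g"] by (simp only: prod.collapse)
  qed
qed

text \<open>Each generating family consists of open sets of the other topology: an essential support
  is a union of graphs of matrix units of \<open>A\<close>, and each such graph is itself an
  essential support.\<close>

lemma fundamental_topology_eq:
  "fundamental_topology M A = topology_generated_by (essential_support D ` A)"
proof -
  have "openin (fundamental_topology M A) (essential_support D a)" if a: "a \<in> A" for a
  proof -
    define \<U> where "\<U> = {graph_of D u | u. u \<in> matrix_units_in M A \<and> graph_of D u \<subseteq> essential_support D a}"
    have "essential_support D a = \<Union>\<U>"
    proof
      show "essential_support D a \<subseteq> \<Union>\<U>"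
      proof (rule subrelI)
        fix x y assume "(x, y) \<in> essential_support D a"
        then obtain u where "u \<in> matrix_units_in M A" "(x, y) \<in> graph_of D u"
          "graph_of D u \<subseteq> essential_support D a"
          by (rule essential_support_covered[OF a])
        then show "(x, y) \<in> \<Union>\<U>" unfolding \<U>_def by blast
      qed
    qed (auto simp: \<U>_def)
    moreover have "openin (fundamental_topology M A) U" if "U \<in> \<U>" for U
      using that unfolding fundamental_topology_def \<U>_def
      by (auto intro: topology_generated_by_Basis)
    ultimately show ?thesis by (simp add: openin_Union)
  qed
  moreover have "openin (topology_generated_by (essential_support D ` A)) (graph_of D e)"
    if "e \<in> matrix_units_in M A" for e
    using that essential_support_matrix_unit[OF that, symmetric]
    by (auto intro!: topology_generated_by_Basis simp: matrix_units_in_def)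
  ultimately show ?thesis
    unfolding topology_eq
    by (auto simp: fundamental_topology_def intro: openin_topology_generated_by_coarser)
qed

lemma topspace_fundamental_topology: "topspace (fundamental_topology M A) = fundamental_relation M A"
  by (simp add: fundamental_topology_def fundamental_relation_def)

end

section \<open>Isometric isomorphisms\<close>

lemma isometric_isomorphism_inv_into:
  assumes S: "subalgebra S" and f: "isometric_isomorphism S T f"
  shows "isometric_isomorphism T S (inv_into S f)"
proof -
  have bij: "bij_betw f S T" using f by (simp add: isometric_isomorphism_def)
  note ss = subalgebra_subspace[OF S]
  have inv: "inv_into S f (f x) = x" if "x \<in> S" for x
    using bij that by (rule bij_betw_inv_into_left)
  have f_add: "f (x + y) = f x + f y" and f_mult: "f (x * y) = f x * f y"
    and f_scaleC: "f (c *\<^sub>C x) = c *\<^sub>C f x" and norm_f: "norm (f x) = norm x"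
    if "x \<in> S" "y \<in> S" for x y c
    using f that by (auto simp: isometric_isomorphism_def)
  have "inv_into S f (f x + f y) = x + y" "inv_into S f (f x * f y) = x * y"
    "inv_into S f (c *\<^sub>C f x) = c *\<^sub>C x" if "x \<in> S" "y \<in> S" for x y c
    using inv[of "x + y"] inv[of "x * y"] inv[of "c *\<^sub>C x"] that
      complex_vector.subspace_add[OF ss] complex_vector.subspace_scale[OF ss] subalgebra_mult[OF S]
    by (simp_all add: f_add f_mult f_scaleC)
  moreover have "norm (inv_into S f (f x)) = norm (f x)" if "x \<in> S" for x
    using inv norm_f that by simp
  ultimately show ?thesis
    unfolding isometric_isomorphism_def
    using bij_betw_inv_into[OF bij] bij_betw_imp_surj_on[OF bij] inv by auto
qed

text \<open>Composition with the inverse isomorphism, so that characters travel in the direction of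
  \<open>f\<close>; the restriction to \<open>D'\<close> keeps the result extensional.\<close>

definition pullback :: "'c'::cstar_algebra set \<Rightarrow> ('c' \<Rightarrow> 'c::cstar_algebra) \<Rightarrow> ('c \<Rightarrow> complex) \<Rightarrow> 'c' \<Rightarrow> complex"
  where "pullback D' g x = (\<lambda>d\<in>D'. x (g d))"

text \<open>The inverse \<open>g\<close> is a parameter of its own, so that the assumptions are
  symmetric and \<open>inverse\<close> turns every result into its mirror image.\<close>

locale triangular_isomorphism =
  source: triangular_algebra M A + target: triangular_algebra M' A'
  for M :: "'c::cstar_algebra mu_chain" and A and M' :: "'c'::cstar_algebra mu_chain" and A' +
  fixes f :: "'c \<Rightarrow> 'c'" and g :: "'c' \<Rightarrow> 'c"
  assumes f: "isometric_isomorphism A A' f" and g: "isometric_isomorphism A' A g"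
    and gf: "\<And>a. a \<in> A \<Longrightarrow> g (f a) = a" and fg: "\<And>a. a \<in> A' \<Longrightarrow> f (g a) = a"
begin

lemma inverse: "triangular_isomorphism M' A' M A g f"
  by unfold_locales (simp_all add: f g gf fg)

lemma f_mem: "a \<in> A \<Longrightarrow> f a \<in> A'"
  and f_add: "a \<in> A \<Longrightarrow> b \<in> A \<Longrightarrow> f (a + b) = f a + f b"
  and f_scaleC: "a \<in> A \<Longrightarrow> f (c *\<^sub>C a) = c *\<^sub>C f a"
  and f_mult: "a \<in> A \<Longrightarrow> b \<in> A \<Longrightarrow> f (a * b) = f a * f b"
  and norm_f: "a \<in> A \<Longrightarrow> norm (f a) = norm a"
  using f by (auto simp: isometric_isomorphism_def bij_betw_apply)

lemma f_diff: "a \<in> A \<Longrightarrow> b \<in> A \<Longrightarrow> f (a - b) = f a - f b"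
  using f_add[of "a - b" b]
    complex_vector.subspace_diff[OF subalgebra_subspace[OF source.subalgebra_A]] by simp

text \<open>Diagonal projections are contractive idempotents, hence so are their images, which therefore are
  self-adjoint.\<close>

lemma f_diagonal:
  assumes "d \<in> source.D" shows "f d \<in> target.D"
proof -
  have "source.D \<subseteq> {d \<in> A. f d \<in> target.D}"
  proof (rule source.diagonal_subsetI[where n=0])
    show "closed {d \<in> A. f d \<in> target.D}"
      unfolding closed_sequential_limits
    proof (intro allI impI)
      fix X l
      assume "(\<forall>k. X k \<in> {d \<in> A. f d \<in> target.D}) \<and> X \<longlonglongrightarrow> l"
      then have X: "\<And>k. X k \<in> A" "\<And>k. f (X k) \<in> target.D" and lim: "X \<longlonglongrightarrow> l" by auto
      have l: "l \<in> A" using closed_sequentially[OF source.closed_A _ lim] X by blast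
      have "dist (f (X k)) (f l) = dist (X k) l" for k
        using f_diff[OF X(1) l] norm_f[of "X k - l"] X(1) l
          complex_vector.subspace_diff[OF subalgebra_subspace[OF source.subalgebra_A]]
        by (simp add: dist_norm)
      then have "(\<lambda>k. f (X k)) \<longlonglongrightarrow> f l"
        using lim by (simp add: tendsto_iff)
      then have "f l \<in> target.D"
        using closed_sequentially[OF target.closed_diagonal, of "\<lambda>k. f (X k)"] X(2) by blast
      then show "l \<in> {d \<in> A. f d \<in> target.D}" using l by simp
    qed
    show "complex_vector.subspace {d \<in> A. f d \<in> target.D}"
      using subalgebra_subspace[OF source.subalgebra_A] target.subspace_D f_add f_scaleC f_scaleC[of 0 0]
      by (auto simp: complex_vector.subspace_def)
    fix m
    show "source.diagonal_units m \<subseteq> {d \<in> A. f d \<in> target.D}"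
    proof
      fix p assume p: "p \<in> source.diagonal_units m"
      have pA: "p \<in> A" using source.diagonal_unit_in_D[OF p] source.diagonal_subset by blast
      have "f p * f p = f p"
        using f_mult[OF pA pA] source.diagonal_unit_idem[OF p] by simp
      moreover have "norm (f p) \<le> 1"
        using norm_f[OF pA] source.norm_matrix_unit[OF source.diagonal_unit_matrix_unit[OF p]] by simp
      ultimately have "star (f p) = f p" by (rule contractive_idempotent_selfadjoint)
      then show "p \<in> {d \<in> A. f d \<in> target.D}" using target.diagonalI f_mem pA by blast
    qed
  qed
  then show ?thesis using assms by blast
qed

lemma g_diagonal: "d \<in> target.D \<Longrightarrow> g d \<in> source.D"
  by (rule triangular_isomorphism.f_diagonal[OF inverse])

lemma pullback_character:
  assumes x: "x \<in> characters source.D"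
  shows "pullback target.D g x \<in> characters target.D"
proof -
  interpret inv: triangular_isomorphism M' A' M A g f by (rule inverse)
  have A': "d \<in> A'" if "d \<in> target.D" for d using that target.diagonal_subset by blast
  obtain a where a: "a \<in> source.D" "x a \<noteq> 0" using character_nonzero[OF x] by blast
  have "g (f a) = a" using a(1) source.diagonal_subset gf by blast
  then have "\<exists>d\<in>target.D. pullback target.D g x d \<noteq> 0"
    using a f_diagonal[OF a(1)] by (intro bexI[of _ "f a"]) (simp_all add: pullback_def)
  then show ?thesis
    unfolding characters_def pullback_def
    using target.subspace_D target.mult_D
    by (auto simp: complex_vector.subspace_def inv.f_add inv.f_scaleC inv.f_mult A' g_diagonal
        character_add[OF x] character_scaleC[OF x] character_mult[OF x])
qed

lemma pullback_inverse:
  assumes "x \<in> characters source.D"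
  shows "pullback source.D f (pullback target.D g x) = x"
proof (rule extensionalityI)
  show "pullback source.D f (pullback target.D g x) \<in> extensional source.D"
    by (simp add: pullback_def)
  show "x \<in> extensional source.D" using assms by (rule character_extensional)
  fix d assume d: "d \<in> source.D"
  then have "g (f d) = d" using gf source.diagonal_subset by blast
  then show "pullback source.D f (pullback target.D g x) d = x d"
    using d f_diagonal by (simp add: pullback_def)
qed

lemma continuous_map_pullback:
  "continuous_map (gelfand_spectrum source.D) (gelfand_spectrum target.D) (pullback target.D g)"
proof -
  have eval: "continuous_map (gelfand_spectrum source.D) euclidean (\<lambda>x. x d)" if "d \<in> source.D" for d
    unfolding gelfand_spectrum_def
    using continuous_map_product_projection[OF that, of "\<lambda>_. euclidean"]
    by (rule continuous_map_from_subtopology)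
  have "continuous_map (gelfand_spectrum source.D) (product_topology (\<lambda>_. euclidean) target.D)
      (pullback target.D g)"
    unfolding continuous_map_componentwise
    using eval[OF g_diagonal] by (auto simp: pullback_def)
  then show ?thesis
    unfolding gelfand_spectrum_def[of target.D]
    by (rule continuous_map_into_subtopology)
      (auto simp: gelfand_spectrum_def pullback_character)
qed

text \<open>The map \<open>g\<close> carries the corner \<open>p * f a * q\<close> isometrically to
  \<open>g p * a * g q\<close>, whose outer factors are contractions with value 1 at
  \<open>x\<close> and \<open>y\<close>; so the same \<epsilon> serves.\<close>

lemma essential_support_pullback:
  assumes a: "a \<in> A" and xy: "(x, y) \<in> essential_support source.D a"
  shows "(pullback target.D g x, pullback target.D g y) \<in> essential_support target.D (f a)"
proof -
  interpret inv: triangular_isomorphism M' A' M A g f by (rule inverse)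
  obtain \<epsilon> where x: "x \<in> characters source.D" and y: "y \<in> characters source.D" and \<epsilon>: "0 < \<epsilon>"
    and bound: "corner_bound source.D a x y \<epsilon>"
    by (rule source.essential_supportE[OF xy])
  have "corner_bound target.D (f a) (pullback target.D g x) (pullback target.D g y) \<epsilon>"
    unfolding corner_bound_def
  proof (intro ballI impI)
    fix p q
    assume p: "p \<in> target.D" and q: "q \<in> target.D" and norms: "norm p \<le> 1" "norm q \<le> 1"
      and pq: "pullback target.D g x p = 1" "pullback target.D g y q = 1"
    have A': "p \<in> A'" "q \<in> A'" using p q target.diagonal_subset by auto
    note fa = f_mem[OF a]
    have "g (p * f a * q) = g p * a * g q"
      using A' fa a by (simp add: inv.f_mult target.mult_A gf)
    then have "norm (p * f a * q) = norm (g p * a * g q)"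
      using inv.norm_f[of "p * f a * q"] A' fa by (simp add: target.mult_A)
    also have "\<epsilon> \<le> \<dots>"
      using bound g_diagonal p q norms pq A' by (simp add: corner_bound_def pullback_def inv.norm_f)
    finally show "\<epsilon> \<le> norm (p * f a * q)" .
  qed
  then show ?thesis
    using x y \<epsilon> by (auto simp: essential_support_def pullback_character)
qed

lemma fundamental_relation_pullback:
  assumes "(x, y) \<in> fundamental_relation M A"
  shows "(pullback target.D g x, pullback target.D g y) \<in> fundamental_relation M' A'"
  using assms essential_support_pullback f_mem
  unfolding source.fundamental_relation_eq target.fundamental_relation_eq by blast

text \<open>The preimage of the essential support of \<open>a\<close> is that of \<open>g a\<close>,
  so preimages of generating sets are open.\<close>

lemma continuous_map_fundamental_pullback:
  "continuous_map (fundamental_topology M A) (fundamental_topology M' A')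
     (map_prod (pullback target.D g) (pullback target.D g))"
  (is "continuous_map _ _ ?\<phi>")
proof -
  interpret inv: triangular_isomorphism M' A' M A g f by (rule inverse)
  have "?\<phi> -` essential_support target.D a \<inter> fundamental_relation M A =
      essential_support source.D (g a)" if a: "a \<in> A'" for a
  proof (intro equalityI subrelI)
    fix x y
    assume "(x, y) \<in> ?\<phi> -` essential_support target.D a \<inter> fundamental_relation M A"
    then have R: "(x, y) \<in> fundamental_relation M A"
      and "(pullback target.D g x, pullback target.D g y) \<in> essential_support target.D a"
      by auto
    from inv.essential_support_pullback[OF a this(2)]
    show "(x, y) \<in> essential_support source.D (g a)"
      using source.fundamental_relation_characters[OF R] by (simp add: pullback_inverse)
  next
    fix x y
    assume xy: "(x, y) \<in> essential_support source.D (g a)"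
    note ga = inv.f_mem[OF a]
    have "(x, y) \<in> fundamental_relation M A"
      unfolding source.fundamental_relation_eq using ga xy by blast
    then show "(x, y) \<in> ?\<phi> -` essential_support target.D a \<inter> fundamental_relation M A"
      using essential_support_pullback[OF ga xy] by (simp add: fg a)
  qed
  moreover have "openin (fundamental_topology M A) (essential_support source.D a)" if "a \<in> A" for a
    unfolding source.fundamental_topology_eq using that by (blast intro: topology_generated_by_Basis)
  ultimately have "openin (fundamental_topology M A)
      (?\<phi> -` U \<inter> topspace (fundamental_topology M A))" if "U \<in> essential_support target.D ` A'" for U
    using that inv.f_mem by (auto simp: source.topspace_fundamental_topology)
  moreover have "?\<phi> ` topspace (fundamental_topology M A) \<subseteq> \<Union>(essential_support target.D ` A')"
    unfolding source.topspace_fundamental_topology target.fundamental_relation_eq[symmetric]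
    using fundamental_relation_pullback by auto
  ultimately show ?thesis
    unfolding target.fundamental_topology_eq by (rule continuous_on_generated_topo)
qed

lemma indecomposable_pairs_pullback:
  assumes "(x, z) \<in> indecomposable_pairs (fundamental_relation M A)"
  shows "(pullback target.D g x, pullback target.D g z) \<in>
    indecomposable_pairs (fundamental_relation M' A')"
proof -
  interpret inv: triangular_isomorphism M' A' M A g f by (rule inverse)
  let ?\<phi> = "pullback target.D g" and ?\<psi> = "pullback source.D f"
  have R: "(x, z) \<in> fundamental_relation M A" and ne: "x \<noteq> z"
    and indec: "\<And>y. (x, y) \<in> fundamental_relation M A \<Longrightarrow> (y, z) \<in> fundamental_relation M A \<Longrightarrow>
      x = y \<or> y = z"
    using assms by (auto simp: indecomposable_pairs_def)
  have xz: "?\<psi> (?\<phi> x) = x" "?\<psi> (?\<phi> z) = z"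
    using source.fundamental_relation_characters[OF R] pullback_inverse by auto
  have "?\<phi> x = y \<or> y = ?\<phi> z"
    if y: "(?\<phi> x, y) \<in> fundamental_relation M' A'" "(y, ?\<phi> z) \<in> fundamental_relation M' A'" for y
  proof -
    have "x = ?\<psi> y \<or> ?\<psi> y = z"
      using inv.fundamental_relation_pullback[OF y(1)] inv.fundamental_relation_pullback[OF y(2)]
        indec xz by simp
    moreover have "?\<phi> (?\<psi> y) = y"
      using target.fundamental_relation_characters[OF y(1)] inv.pullback_inverse by blast
    ultimately show ?thesis by auto
  qed
  moreover have "?\<phi> x \<noteq> ?\<phi> z" using ne xz by metis
  ultimately show ?thesis
    using fundamental_relation_pullback[OF R] by (auto simp: indecomposable_pairs_def)
qed

section \<open>Homeomorphisms and conjugacy\<close>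

lemma homeomorphic_maps_spectra:
  "homeomorphic_maps (gelfand_spectrum source.D) (gelfand_spectrum target.D)
     (pullback target.D g) (pullback source.D f)"
proof -
  interpret inv: triangular_isomorphism M' A' M A g f by (rule inverse)
  show ?thesis
    unfolding homeomorphic_maps_def
    using continuous_map_pullback inv.continuous_map_pullback
    by (auto simp: gelfand_spectrum_def pullback_inverse inv.pullback_inverse)
qed

lemma homeomorphic_maps_relations:
  "homeomorphic_maps (fundamental_topology M A) (fundamental_topology M' A')
     (map_prod (pullback target.D g) (pullback target.D g))
     (map_prod (pullback source.D f) (pullback source.D f))"
proof -
  interpret inv: triangular_isomorphism M' A' M A g f by (rule inverse)
  show ?thesis
    unfolding homeomorphic_maps_def source.topspace_fundamental_topology
      target.topspace_fundamental_topology
    using continuous_map_fundamental_pullback inv.continuous_map_fundamental_pullback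
    by (auto simp: pullback_inverse inv.pullback_inverse
        dest: source.fundamental_relation_characters target.fundamental_relation_characters)
qed

lemma indecomposable_pairs_image:
  "map_prod (pullback target.D g) (pullback target.D g) `
     indecomposable_pairs (fundamental_relation M A) =
   indecomposable_pairs (fundamental_relation M' A')"
proof -
  interpret inv: triangular_isomorphism M' A' M A g f by (rule inverse)
  show ?thesis
  proof (intro equalityI subrelI)
    fix x z
    assume xz: "(x, z) \<in> indecomposable_pairs (fundamental_relation M' A')"
    then have "x \<in> characters target.D \<and> z \<in> characters target.D"
      using target.fundamental_relation_characters by (auto simp: indecomposable_pairs_def)
    then have "(x, z) = map_prod (pullback target.D g) (pullback target.D g)
        (pullback source.D f x, pullback source.D f z)"
      by (simp add: inv.pullback_inverse)
    then show "(x, z) \<in> map_prod (pullback target.D g) (pullback target.D g) `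
        indecomposable_pairs (fundamental_relation M A)"
      using inv.indecomposable_pairs_pullback[OF xz] by (rule image_eqI)
  qed (auto intro: indecomposable_pairs_pullback)
qed

text \<open>Indecomposability cuts the edges out of the relation, and the homeomorphism of relations
  respects it. Since the edge map is \<open>map_prod\<close> of the vertex map with itself, it
  intertwines the range and source maps by its very form.\<close>

lemma conjugate_associated_graphs:
  assumes "continuous_coherent_cocycle M A \<delta>" "continuous_coherent_cocycle M' A' \<delta>'"
  shows "conjugate (associated_graph M A \<delta>) (associated_graph M' A' \<delta>')"
proof -
  let ?\<phi> = "pullback target.D g" and ?\<psi> = "pullback source.D f"
  have E: "{g \<in> fundamental_relation M A. \<delta> g = 1} = indecomposable_pairs (fundamental_relation M A)"
    and E': "{g \<in> fundamental_relation M' A'. \<delta>' g = 1} =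
      indecomposable_pairs (fundamental_relation M' A')"
    using source.edges_indecomposable[OF assms(1)] target.edges_indecomposable[OF assms(2)]
    by simp_all
  have sub: "R \<inter> indecomposable_pairs R = indecomposable_pairs R" for R :: "('a \<times> 'a) set"
    by (auto simp: indecomposable_pairs_def)
  have "homeomorphic_maps
      (subtopology (fundamental_topology M A) (indecomposable_pairs (fundamental_relation M A)))
      (subtopology (fundamental_topology M' A') (indecomposable_pairs (fundamental_relation M' A')))
      (map_prod ?\<phi> ?\<phi>) (map_prod ?\<psi> ?\<psi>)"
    using homeomorphic_maps_relations
    by (rule homeomorphic_maps_subtopologies)
      (simp add: source.topspace_fundamental_topology target.topspace_fundamental_topology sub
        indecomposable_pairs_image)
  then have "homeomorphic_map (edges (associated_graph M A \<delta>)) (edges (associated_graph M' A' \<delta>'))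
      (map_prod ?\<phi> ?\<phi>)"
    by (auto simp: associated_graph_def E E' homeomorphic_map_maps)
  moreover have "homeomorphic_map (vertices (associated_graph M A \<delta>))
      (vertices (associated_graph M' A' \<delta>')) ?\<phi>"
    using homeomorphic_maps_spectra by (auto simp: associated_graph_def homeomorphic_map_maps)
  ultimately show ?thesis
    unfolding conjugate_def
    by (intro exI[of _ ?\<phi>] exI[of _ "map_prod ?\<phi> ?\<phi>"]) (auto simp: associated_graph_def)
qed

end

theorem corollary5p3:
  fixes M :: "'c::cstar_algebra mu_chain" and A :: "'c set"
    and M' :: "'c'::cstar_algebra mu_chain" and A' :: "'c' set"
    and X :: "('d::cstar_algebra, 'x::complex_vector) correspondence"
    and \<pi> :: "'d \<Rightarrow> 'b::cstar_algebra" and t :: "'x \<Rightarrow> 'b"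
    and X' :: "('d'::cstar_algebra, 'x'::complex_vector) correspondence"
    and \<pi>' :: "'d' \<Rightarrow> 'b'::cstar_algebra" and t' :: "'x' \<Rightarrow> 'b'"
    and \<delta> :: "('c \<Rightarrow> complex) \<times> ('c \<Rightarrow> complex) \<Rightarrow> real"
    and \<delta>' :: "('c' \<Rightarrow> complex) \<times> ('c' \<Rightarrow> complex) \<Rightarrow> real"
  assumes "triangular_limit_algebra M A"
    and "triangular_limit_algebra M' A'"
    and "cstar_correspondence X" and "universal_toeplitz X \<pi> t"
    and "isometrically_isomorphic A (tensor_algebra \<pi> t)"
    and "cstar_correspondence X'" and "universal_toeplitz X' \<pi>' t'"
    and "isometrically_isomorphic A' (tensor_algebra \<pi>' t')"
    and "continuous_coherent_cocycle M A \<delta>"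
    and "continuous_coherent_cocycle M' A' \<delta>'"
    and "isometrically_isomorphic A A'"
  shows "conjugate (associated_graph M A \<delta>) (associated_graph M' A' \<delta>')"
proof -
  interpret source: triangular_algebra M A by (rule triangular_algebraI) fact
  interpret target: triangular_algebra M' A' by (rule triangular_algebraI) fact
  obtain f where f: "isometric_isomorphism A A' f"
    using assms(11) by (auto simp: isometrically_isomorphic_def)
  have bij: "bij_betw f A A'" using f by (simp add: isometric_isomorphism_def)
  interpret triangular_isomorphism M A M' A' f "inv_into A f"
    by unfold_locales
      (use f isometric_isomorphism_inv_into[OF source.subalgebra_A f]
        bij_betw_inv_into_left[OF bij] bij_betw_inv_into_right[OF bij] in auto)
  show ?thesis by (rule conjugate_associated_graphs) fact+
qed

end
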